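(* Let $\alpha\le 0$ be a real constant, let $p=p(n)=n^\alpha$, and let $G\sim\vec{G}(n,p(n))$ be an Erdős–Rényi random directed graph. Let $\vec\beta_1=\vec\beta_1(G)$ denote the first Betti number of its non-regular path homology. Then: (a) if $-1<\alpha<-2/3$ then $\mathbb{E}[\vec\beta_1]$ grows like $n(n-1)p$, i.e. $\lim_{n\to\infty}\mathbb{E}[\vec\beta_1]/(n(n-1)p)=1$; (b) if $-1<\alpha<-2/3$ then $\vec\beta_1>0$ with high probability; (c) if $\alpha<-1$ then $\vec\beta_1=0$ with high probability; (d) if $\alpha>-1/3$ then $\vec\beta_1=0$ with high probability. The same result holds with $\vec\beta_1(G)$ replaced by the first Betti number $\vec\beta^{\mathrm{reg}}_1(G)$ of regular path homology.
   Context: A simple digraph is $G=(V,E)$ with $E\subseteq\{(i,j)\in V\times V: i\neq j\}$ (both $(i,j)$ and $(j,i)$ may be present). $\vec{G}(n,p)$ is the random simple digraph on vertex set $\{1,\dots,n\}$ in which each of the $n(n-1)$ possible directed edges is present independently with probability $p$. A property holds with high probability if its probability tends to $1$ as $n\to\infty$. Path homology (coefficients in $\mathbb{Z}$). For $m\ge 0$ let $\Lambda_m$ be the free $\mathbb{Z}$-module with basis $e_{v_0\dots v_m}$ over all sequences of $m+1$ vertices, and let $\mathcal{A}_m\subseteq\Lambda_m$ be the submodule spanned by the allowed sequences, i.e. those with $(v_i,v_{i+1})\in E$ for all $i$. Put $\Lambda_{-1}=\mathcal{A}_{-1}=\mathbb{Z}$. For $m\geq 1$ let $\partial_m:\Lambda_m\to\Lambda_{m-1}$,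 $\partial_m(e_{v_0\dots v_m})=\sum_{i=0}^m(-1)^i e_{v_0\dots\hat{v_i}\dots v_m}$, and let $\partial_0:\Lambda_0\to\mathbb{Z}$ be the sum of coefficients. Let $\Omega_m=\{v\in\mathcal{A}_m:\partial_m v\in\mathcal{A}_{m-1}\}$ for $m\ge0$ and $\Omega_{-1}=\mathbb{Z}$. The non-regular chain complex is $\cdots\to\Omega_2\to\Omega_1\to\Omega_0\to\mathbb{Z}\to0$ with the restrictions of $\partial_m$; its homology is non-regular path homology and $\vec\beta_k(G)=\operatorname{rank}(\ker\partial_k/\operatorname{im}\partial_{k+1})$. For the regular version, let $\pi$ be the projection sending every basis sequence having two equal consecutive vertices to $0$ and fixing the others, let $\partial^{\mathrm{reg}}_m=\pi\circ\partial_m$, $\Omega^{\mathrm{reg}}_m=\{v\in\mathcal{A}_m:\partial^{\mathrm{reg}}_m v\in\mathcal{A}_{m-1}\}$ (again augmented by $\mathbb{Z}$ in degree $-1$); $\vec\beta^{\mathrm{reg}}_k(G)$ is the rank of the $k$-th homology group of this complex. *)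

theory Defs
  imports
    "HOL-Probability.Probability"
    "HOL-Probability.Product_PMF"
    "HOL-Algebra.Free_Abelian_Groups"
    "Graph_Theory.Pair_Digraph"
begin

section \<open>Erdos-Renyi random digraphs\<close>

definition possible_arcs :: "nat \<Rightarrow> (nat \<times> nat) set" where
  "possible_arcs n = {(i, j). i \<in> {1..n} \<and> j \<in> {1..n} \<and> i \<noteq> j}"

definition er_digraph :: "nat \<Rightarrow> real \<Rightarrow> nat pair_pre_digraph pmf" where
  "er_digraph n p =
     map_pmf (\<lambda>f. \<lparr>pverts = {1..n}, parcs = {e. f e}\<rparr>)
       (Pi_pmf (possible_arcs n) False (\<lambda>_. bernoulli_pmf p))"

definition whp :: "(nat \<Rightarrow> 'a pmf) \<Rightarrow> ('a \<Rightarrow> bool) \<Rightarrow> bool" where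
  "whp M P \<longleftrightarrow> (\<lambda>n. measure_pmf.prob (M n) {x. P x}) \<longlonglongrightarrow> 1"

section \<open>Rank of an abelian group\<close>

definition int_independent :: "('a, 'b) monoid_scheme \<Rightarrow> 'a set \<Rightarrow> bool" where
  "int_independent G A \<longleftrightarrow>
     finite A \<and> A \<subseteq> carrier G \<and>
     (\<forall>c :: 'a \<Rightarrow> int. (\<Otimes>\<^bsub>G\<^esub>a\<in>A. a [^]\<^bsub>G\<^esub> c a) = \<one>\<^bsub>G\<^esub> \<longrightarrow> (\<forall>a\<in>A. c a = 0))"

text \<open>
  This is the usual rank for abelian groups of finite rank, in particular for
  finitely generated ones. The supremum is meaningless if the rank is infinite.
\<close>

definition group_rank :: "('a, 'b) monoid_scheme \<Rightarrow> nat" where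
  "group_rank G = Sup {card A |A. int_independent G A}"

section \<open>Path homology\<close>

text \<open>
  Sequences of \<open>m + 1\<close> vertices are lists of length \<open>m + 1\<close>. In degree \<open>- 1\<close> the only
  sequence is the empty list, which is allowed; this gives the augmentation by the integers,
  and the general formula for the boundary, which sends a one-element list to the empty list,
  gives the sum of the coefficients in degree \<open>0\<close>.
\<close>

definition allowed_seqs :: "'v pair_pre_digraph \<Rightarrow> int \<Rightarrow> 'v list set" where
  "allowed_seqs G m =
     {xs. int (length xs) = m + 1 \<and> set xs \<subseteq> pverts G \<and>
          successively (\<lambda>u v. (u, v) \<in> parcs G) xs}"

definition allowed_chains :: "'v pair_pre_digraph \<Rightarrow> int \<Rightarrow> ('v list \<Rightarrow>\<^sub>0 int) set" where
  "allowed_chains G m = carrier (free_Abelian_group (allowed_seqs G m))"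

definition path_boundary :: "('v list \<Rightarrow>\<^sub>0 int) \<Rightarrow> ('v list \<Rightarrow>\<^sub>0 int)" where
  "path_boundary = frag_extend (\<lambda>xs. \<Sum>i<length xs.
     frag_cmul ((-1) ^ i) (frag_of (take i xs @ drop (Suc i) xs)))"

definition reg_proj :: "('v list \<Rightarrow>\<^sub>0 int) \<Rightarrow> ('v list \<Rightarrow>\<^sub>0 int)" where
  "reg_proj = frag_extend (\<lambda>xs. if distinct_adj xs then frag_of xs else 0)"

definition reg_path_boundary :: "('v list \<Rightarrow>\<^sub>0 int) \<Rightarrow> ('v list \<Rightarrow>\<^sub>0 int)" where
  "reg_path_boundary = reg_proj \<circ> path_boundary"

text \<open>
  The following notions take the boundary map \<open>D\<close> as a parameter, so that they cover both the
  non-regular and the regular complex.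
\<close>

definition invariant_chains ::
    "(('v list \<Rightarrow>\<^sub>0 int) \<Rightarrow> ('v list \<Rightarrow>\<^sub>0 int)) \<Rightarrow> 'v pair_pre_digraph \<Rightarrow> int
      \<Rightarrow> ('v list \<Rightarrow>\<^sub>0 int) set" where
  "invariant_chains D G m = {c \<in> allowed_chains G m. D c \<in> allowed_chains G (m - 1)}"

definition path_cycles ::
    "(('v list \<Rightarrow>\<^sub>0 int) \<Rightarrow> ('v list \<Rightarrow>\<^sub>0 int)) \<Rightarrow> 'v pair_pre_digraph \<Rightarrow> int
      \<Rightarrow> ('v list \<Rightarrow>\<^sub>0 int) set" where
  "path_cycles D G k = {c \<in> invariant_chains D G k. D c = 0}"

definition path_homology_group ::
    "(('v list \<Rightarrow>\<^sub>0 int) \<Rightarrow> ('v list \<Rightarrow>\<^sub>0 int)) \<Rightarrow> 'v pair_pre_digraph \<Rightarrow> int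
      \<Rightarrow> ('v list \<Rightarrow>\<^sub>0 int) set monoid" where
  "path_homology_group D G k =
     (free_Abelian_group (allowed_seqs G k))\<lparr>carrier := path_cycles D G k\<rparr>
       Mod (D ` invariant_chains D G (k + 1))"

definition path_betti :: "int \<Rightarrow> 'v pair_pre_digraph \<Rightarrow> nat" where
  "path_betti k G = group_rank (path_homology_group path_boundary G k)"

definition reg_path_betti :: "int \<Rightarrow> 'v pair_pre_digraph \<Rightarrow> nat" where
  "reg_path_betti k G = group_rank (path_homology_group reg_path_boundary G k)"

end

theory Submission
  imports Defs "HOL-Real_Asymp.Real_Asymp"
begin

text \<open>
  The cycle group in degree 1 has rank at least \<open>|E| - n\<close>, and the boundaries are spanned by the
  images of those paths \<open>u \<rightarrow> v \<rightarrow> w\<close> that can occur in an invariant 2-chain: \<open>u = w\<close>, or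
  \<open>u \<rightarrow> w\<close> is an arc, or there is a second path from \<open>u\<close> to \<open>w\<close>. Their expected number is at most
  \<open>n\<^sup>2p\<^sup>2 + n\<^sup>3p\<^sup>3 + n\<^sup>4p\<^sup>4\<close>, which together with \<open>n\<close> is negligible against
  \<open>E|E| = n(n - 1)p\<close> for \<open>-1 < \<alpha> < -2/3\<close>; concentration of \<open>|E|\<close> gives positivity.
  If \<open>\<alpha> < -1\<close>, a nonzero cycle would yield \<open>k\<close> vertices carrying \<open>k\<close> arcs, which a union bound
  excludes. If \<open>\<alpha> > -1/3\<close>, any three vertices have a common in-neighbour, and coning off from such
  vertices fills every cycle.
\<close>

section \<open>Independence modulo a subgroup\<close>

text \<open>Ranks are handled over the integers without passing to the rationals: a family is
  independent modulo a subgroup, and each linear condition imposed on it, or each generator added to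
  the subgroup, costs at most one member. Division being absent, pivots are cleared by
  cross-multiplication. On allowed sequences of two or three vertices the two complexes differ only
  in the middle face of \<open>[u, v, u]\<close>, so one parameter covers both. Betti numbers reach
  the probabilistic part only through statements about a single digraph, and what remains is to
  estimate fixed arc patterns. These explain the thresholds. Relative to n^2 p, the n vertices weigh
  n^(-1-\<alpha>) and the n^4 p^4 pairs of parallel paths weigh n^(2+3\<alpha>), and both must tend
  to 0. Choosing k vertices with k arcs leads to a geometric series in n p, small for \<alpha> < -1.
  Three vertices have about n p^3 common in-neighbours, a positive power of n for \<alpha> >
  -1/3.\<close>

interpretation frag: module frag_cmul
  by unfold_locales (simp_all add: frag_cmul_distrib frag_cmul_distrib2)

(* Together with minus_frag_cmul this simp rule loops. *)
declare frag.scale_minus_left [simp del]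

text \<open>Linear independence over the integers of the images in the quotient by \<open>B\<close>.
  The family is indexed, so that vectors can be replaced while the index set only shrinks.\<close>

definition indep_mod :: "('a \<Rightarrow>\<^sub>0 int) set \<Rightarrow> 'i set \<Rightarrow> ('i \<Rightarrow> 'a \<Rightarrow>\<^sub>0 int) \<Rightarrow> bool" where
  "indep_mod B I a \<longleftrightarrow> finite I \<and>
     (\<forall>c. (\<Sum>i\<in>I. frag_cmul (c i) (a i)) \<in> B \<longrightarrow> (\<forall>i\<in>I. c i = 0))"

lemma indep_modD:
  "\<lbrakk>indep_mod B I a; (\<Sum>i\<in>I. frag_cmul (c i) (a i)) \<in> B; i \<in> I\<rbrakk> \<Longrightarrow> c i = 0"
  unfolding indep_mod_def by blast

lemma indep_mod_mono: "indep_mod B I a \<Longrightarrow> B' \<subseteq> B \<Longrightarrow> indep_mod B' I a"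
  unfolding indep_mod_def by blast

lemma indep_mod_frag_of: "finite X \<Longrightarrow> indep_mod {0} X frag_of"
proof (unfold indep_mod_def, intro conjI allI impI ballI)
  fix c :: "'a \<Rightarrow> int" and x
  assume X: "finite X" and c: "(\<Sum>i\<in>X. frag_cmul (c i) (frag_of i)) \<in> {0}" and x: "x \<in> X"
  have "0 = Poly_Mapping.lookup (\<Sum>i\<in>X. frag_cmul (c i) (frag_of i)) x"
    using c by simp
  also have "\<dots> = (\<Sum>i\<in>X. c i * (if x = i then 1 else 0))"
    by (simp add: lookup_sum)
  also have "\<dots> = (\<Sum>i\<in>X. if x = i then c i else 0)"
    by (intro sum.cong) auto
  also have "\<dots> = c x" using X x by simp
  finally show "c x = 0" by simp
qed

text \<open>Passing to the kernel of one functional costs one pivot. If \<open>h (a r)\<close> is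
  nonzero, every other \<open>a i\<close> is scaled by \<open>h (a r)\<close> and corrected by a
  multiple of \<open>a r\<close>; the scaling replaces a division.\<close>

lemma indep_mod_kernel_step:
  fixes h :: "('a \<Rightarrow>\<^sub>0 int) \<Rightarrow> int"
  assumes ind: "indep_mod B I a" and a: "a ` I \<subseteq> Z" and Z: "frag.subspace Z"
    and h: "\<And>x y. h (x + y) = h x + h y" "\<And>k x. h (frag_cmul k x) = k * h x"
  obtains J a' where "J \<subseteq> I" "card I \<le> card J + 1" "indep_mod B J a'"
    "a' ` J \<subseteq> Z" "\<forall>x\<in>a' ` J. h x = 0"
proof (cases "\<forall>i\<in>I. h (a i) = 0")
  case True
  then show ?thesis using that[of I a] ind a by auto
next
  case False
  have hd: "h (x - y) = h x - h y" for x y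
    using h(1)[of x "frag_cmul (-1) y"] h(2)[of "-1" y] by simp
  from False obtain r where r: "r \<in> I" "h (a r) \<noteq> 0" by auto
  define b where "b i = frag_cmul (h (a r)) (a i) - frag_cmul (h (a i)) (a r)" for i
  have fin: "finite I" using ind by (simp add: indep_mod_def)
  show ?thesis
  proof (rule that[of "I - {r}" b])
    show "indep_mod B (I - {r}) b"
      unfolding indep_mod_def
    proof (intro conjI allI impI ballI)
      fix c i
      assume c: "(\<Sum>i\<in>I - {r}. frag_cmul (c i) (b i)) \<in> B" and i: "i \<in> I - {r}"
      \<comment> \<open>The same combination written in the vectors \<open>a i\<close>: the pivot
        collects a contribution from every \<open>b i\<close>, and each other coefficient is
        multiplied by the nonzero \<open>h (a r)\<close>, so \<open>d i = 0\<close> forces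
        \<open>c i = 0\<close>.\<close>
      define d where "d i = (if i = r then - (\<Sum>j\<in>I - {r}. c j * h (a j)) else c i * h (a r))" for i
      have "(\<Sum>i\<in>I. frag_cmul (d i) (a i))
          = frag_cmul (d r) (a r) + (\<Sum>i\<in>I - {r}. frag_cmul (d i) (a i))"
        using fin r by (simp add: sum.remove)
      also have "(\<Sum>i\<in>I - {r}. frag_cmul (d i) (a i))
          = (\<Sum>i\<in>I - {r}. frag_cmul (c i * h (a r)) (a i))"
        by (intro sum.cong) (auto simp: d_def)
      also have "frag_cmul (d r) (a r) = (\<Sum>i\<in>I - {r}. frag_cmul (- (c i * h (a i))) (a r))"
        by (simp only: d_def if_True refl sum_negf[symmetric] frag.scale_sum_left)
      also have "\<dots> + (\<Sum>i\<in>I - {r}. frag_cmul (c i * h (a r)) (a i))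
          = (\<Sum>i\<in>I - {r}. frag_cmul (c i) (b i))"
        by (simp add: b_def frag.scale_right_diff_distrib sum_subtractf flip: sum_negf)
      finally have "d i = 0" using indep_modD[OF ind, of d i] c i by auto
      then show "c i = 0" using r i by (simp add: d_def)
    qed (use fin in auto)
    show "b ` (I - {r}) \<subseteq> Z"
      using Z a r unfolding b_def
      by (auto intro!: frag.subspace_diff frag.subspace_scale)
  qed (use fin r h hd in \<open>auto simp: b_def\<close>)
qed

text \<open>The functionals are treated in turn; the ambient subgroup shrinks to the common kernel
  of those already treated, so that later pivoting cannot leave it.\<close>

lemma indep_mod_kernel:
  fixes h :: "'k \<Rightarrow> ('a \<Rightarrow>\<^sub>0 int) \<Rightarrow> int"
  assumes "finite K" and ind: "indep_mod B I a" and a: "a ` I \<subseteq> Z" and Z: "frag.subspace Z"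
    and h: "\<And>k x y. h k (x + y) = h k x + h k y" "\<And>k m x. h k (frag_cmul m x) = m * h k x"
  obtains J a' where "J \<subseteq> I" "card I \<le> card J + card K" "indep_mod B J a'"
    "a' ` J \<subseteq> {x \<in> Z. \<forall>k\<in>K. h k x = 0}"
  using assms(1)
proof (induction K arbitrary: thesis)
  case empty
  then show ?case using ind a by auto
next
  case (insert k K)
  obtain J a' where J: "J \<subseteq> I" "card I \<le> card J + card K" "indep_mod B J a'"
    "a' ` J \<subseteq> {x \<in> Z. \<forall>k\<in>K. h k x = 0}"
    by (rule insert.IH)
  have 0: "h k 0 = 0" for k using h(2)[of k 0 0] by simp
  have "frag.subspace {x \<in> Z. \<forall>k\<in>K. h k x = 0}"
    using Z by (auto simp: frag.subspace_def h 0)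
  then obtain J' a'' where "J' \<subseteq> J" "card J \<le> card J' + 1" "indep_mod B J' a''"
    "a'' ` J' \<subseteq> {x \<in> Z. \<forall>k\<in>K. h k x = 0}" "\<forall>x\<in>a'' ` J'. h k x = 0"
    by (rule indep_mod_kernel_step[where h = "h k", OF J(3,4) _ h])
  then show ?case using J insert.hyps by (intro insert.prems[of J' a'']) auto
qed

text \<open>One new generator \<open>b\<close> costs at most one member. If it destroys independence
  through a relation with \<open>c r\<close> nonzero, dropping \<open>r\<close> restores it, because
  any further relation can be combined with the first to eliminate \<open>b\<close>.\<close>

lemma indep_mod_span:
  fixes S :: "('a \<Rightarrow>\<^sub>0 int) set"
  assumes "finite S" "indep_mod {0} I a"
  obtains J where "J \<subseteq> I" "card I \<le> card J + card S" "indep_mod (frag.span S) J a"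
  using assms(1)
proof (induction S arbitrary: thesis)
  case empty
  then show ?case using assms by auto
next
  case (insert b S)
  obtain J where J: "J \<subseteq> I" "card I \<le> card J + card S" "indep_mod (frag.span S) J a"
    by (rule insert.IH)
  have fin: "finite J" using J by (simp add: indep_mod_def)
  show ?case
  proof (cases "indep_mod (frag.span (insert b S)) J a")
    case True
    then show ?thesis using J insert.hyps by (intro insert.prems[of J]) auto
  next
    case False
    then obtain c r where c: "(\<Sum>i\<in>J. frag_cmul (c i) (a i)) \<in> frag.span (insert b S)"
      and r: "r \<in> J" "c r \<noteq> 0"
      using fin by (auto simp: indep_mod_def)
    obtain k where k: "(\<Sum>i\<in>J. frag_cmul (c i) (a i)) - frag_cmul k b \<in> frag.span S"
      using c by (auto simp: frag.span_breakdown_eq)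
    have "indep_mod (frag.span (insert b S)) (J - {r}) a"
      unfolding indep_mod_def
    proof (intro conjI allI impI ballI)
      fix d i
      assume d: "(\<Sum>i\<in>J - {r}. frag_cmul (d i) (a i)) \<in> frag.span (insert b S)" and i: "i \<in> J - {r}"
      obtain l where l: "(\<Sum>i\<in>J - {r}. frag_cmul (d i) (a i)) - frag_cmul l b \<in> frag.span S"
        using d by (auto simp: frag.span_breakdown_eq)
      define e where "e i = (if i = r then 0 else d i)" for i
      have e: "(\<Sum>i\<in>J - {r}. frag_cmul (d i) (a i)) = (\<Sum>i\<in>J. frag_cmul (e i) (a i))"
        using fin by (intro sum.mono_neutral_cong_left) (auto simp: e_def)
      \<comment> \<open>The two relations contain \<open>b\<close> with multiples \<open>k\<close>
        and \<open>l\<close>; cross-multiplying cancels it.\<close>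
      have "(\<Sum>i\<in>J. frag_cmul (k * e i - l * c i) (a i))
         = frag_cmul k ((\<Sum>i\<in>J. frag_cmul (e i) (a i)) - frag_cmul l b)
           - frag_cmul l ((\<Sum>i\<in>J. frag_cmul (c i) (a i)) - frag_cmul k b)"
        by (simp add: frag.scale_right_diff_distrib frag_cmul_diff_distrib sum_subtractf
            frag_cmul_sum mult.commute)
      also have "\<dots> \<in> frag.span S"
        using k l unfolding e by (blast intro: frag.span_diff frag.span_scale)
      finally have *: "\<forall>i\<in>J. k * e i - l * c i = 0"
        using indep_modD[OF J(3), of "\<lambda>i. k * e i - l * c i"] by auto
      \<comment> \<open>At \<open>r\<close> the coefficient \<open>e r\<close> is 0 and
        \<open>c r\<close> is not. Hence \<open>l = 0\<close>, and the second relation already lies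
        in the span of \<open>S\<close>.\<close>
      then have "l = 0" using r by (force simp: e_def)
      then show "d i = 0" using indep_modD[OF J(3), of e i] l e i by (auto simp: e_def)
    qed (use fin in auto)
    then show ?thesis using J r fin insert.hyps by (intro insert.prems[of "J - {r}"]) auto
  qed
qed

text \<open>The coordinates at \<open>K\<close> serve as functionals: a chain supported in
  \<open>K\<close> on which they all vanish is zero, and a nonempty family of zeros is never
  independent.\<close>

lemma indep_mod_card_le:
  assumes "indep_mod B I a" "0 \<in> B" "finite K" "\<And>i. i \<in> I \<Longrightarrow> Poly_Mapping.keys (a i) \<subseteq> K"
  shows "card I \<le> card K"
proof -
  have sub: "frag.subspace {x. Poly_Mapping.keys x \<subseteq> K}"
    by (auto simp: frag.subspace_def dest: subsetD[OF keys_add])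
  obtain J a' where J: "J \<subseteq> I" "card I \<le> card J + card K" "indep_mod B J a'"
    "a' ` J \<subseteq> {x \<in> {x. Poly_Mapping.keys x \<subseteq> K}. \<forall>k\<in>K. Poly_Mapping.lookup x k = 0}"
    by (rule indep_mod_kernel[where h = "\<lambda>k x. Poly_Mapping.lookup x k",
          OF assms(3,1) _ sub, of thesis])
       (use assms(4) in \<open>auto simp: lookup_add\<close>)
  have "J = {}"
  proof (rule ccontr)
    assume "J \<noteq> {}"
    then obtain j where "j \<in> J" by auto
    have "a' i = 0" if "i \<in> J" for i
      using J(4) that by (intro poly_mapping_eqI) (auto simp: in_keys_iff image_subset_iff subset_iff)
    then have "(1::int) = 0"
      using indep_modD[OF J(3), of "\<lambda>_. 1" j] \<open>j \<in> J\<close> assms(2) by simp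
    then show False by simp
  qed
  then show ?thesis using J by simp
qed

section \<open>Rank of a quotient of chain groups\<close>

text \<open>Cycles \<open>Z\<close> modulo boundaries \<open>B\<close> inside the free group on
  \<open>S\<close>, in the form in which \<open>path_homology_group\<close> builds its
  quotient.\<close>

locale frag_quotient =
  fixes S :: "'a set" and Z B :: "('a \<Rightarrow>\<^sub>0 int) set"
  assumes Z: "frag.subspace Z" and B: "frag.subspace B" and BZ: "B \<subseteq> Z"
    and ZS: "Z \<subseteq> carrier (free_Abelian_group S)"
begin

abbreviation "C \<equiv> (free_Abelian_group S)\<lparr>carrier := Z\<rparr>"
abbreviation "Q \<equiv> C Mod B"

lemma subgroup_Z: "subgroup Z (free_Abelian_group S)"
  using ZS Z by (unfold_locales)
    (auto simp: frag.subspace_0 frag.subspace_add frag.subspace_neg subset_iff)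

sublocale C: comm_group C
  by (intro group.group_comm_groupI subgroup.subgroup_is_group[OF subgroup_Z])
     (simp_all add: add.commute)

lemma subgroup_B: "subgroup B C"
  by (rule group.subgroup_incl[OF group_free_Abelian_group _ subgroup_Z BZ])
     (use BZ ZS B in \<open>unfold_locales, auto simp: frag.subspace_0 frag.subspace_add frag.subspace_neg subset_iff\<close>)

sublocale Q: comm_group Q
  by (rule C.abelian_FactGroup[OF subgroup_B])

definition coset :: "('a \<Rightarrow>\<^sub>0 int) \<Rightarrow> ('a \<Rightarrow>\<^sub>0 int) set" where
  "coset z = B #>\<^bsub>C\<^esub> z"

lemma coset_hom: "coset \<in> hom C Q"
proof -
  have "coset = (#>\<^bsub>C\<^esub>) B" by (simp add: coset_def fun_eq_iff)
  then show ?thesis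
    using normal.r_coset_hom_Mod[of B C] by (simp only: C.normal_iff_subgroup subgroup_B)
qed

lemma coset_eq_one_iff: "z \<in> Z \<Longrightarrow> coset z = \<one>\<^bsub>Q\<^esub> \<longleftrightarrow> z \<in> B"
  using C.coset_join1[of B z] C.coset_join2[of z B] subgroup_B BZ C.rcos_self[of z B]
  by (auto simp: coset_def subgroup_B)

lemma carrier_Q: "carrier Q = coset ` Z"
  by (simp add: carrier_FactGroup coset_def)

lemma coset_in_carrier: "z \<in> Z \<Longrightarrow> coset z \<in> carrier Q"
  by (simp add: carrier_Q)

text \<open>Turns products of powers in the multiplicative quotient into integer combinations of
  representatives; both translations between \<open>int_independent\<close> and
  \<open>indep_mod\<close> rest on it.\<close>

lemma finprod_coset:
  assumes "finite I" "a ` I \<subseteq> Z"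
  shows "(\<Otimes>\<^bsub>Q\<^esub>i\<in>I. coset (a i) [^]\<^bsub>Q\<^esub> (c i :: int)) = coset (\<Sum>i\<in>I. frag_cmul (c i) (a i))"
proof -
  have pow: "coset x [^]\<^bsub>Q\<^esub> (k :: int) = coset (frag_cmul k x)" if "x \<in> Z" for x k
  proof -
    have "coset x [^]\<^bsub>Q\<^esub> k = coset (x [^]\<^bsub>C\<^esub> k)"
      using hom_int_pow[OF coset_hom, of x k] that by (simp add: C.is_group Q.is_group)
    also have "x [^]\<^bsub>C\<^esub> k = x [^]\<^bsub>free_Abelian_group S\<^esub> k"
      using group.int_pow_consistent[OF group_free_Abelian_group subgroup_Z that, of k] by simp
    also have "\<dots> = frag_cmul k x" using that ZS by auto
    finally show ?thesis .
  qed
  show ?thesis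
    using assms
  proof (induction I)
    case empty
    then show ?case using coset_eq_one_iff[of 0] B Z by (simp add: frag.subspace_0)
  next
    case (insert i I)
    have sum: "(\<Sum>i\<in>I. frag_cmul (c i) (a i)) \<in> Z"
      using insert.prems Z by (auto intro!: frag.subspace_sum frag.subspace_scale)
    have aZ: "frag_cmul (c i) (a i) \<in> Z"
      using insert.prems Z by (auto intro!: frag.subspace_scale)
    have "(\<Otimes>\<^bsub>Q\<^esub>i\<in>insert i I. coset (a i) [^]\<^bsub>Q\<^esub> c i)
        = coset (a i) [^]\<^bsub>Q\<^esub> c i \<otimes>\<^bsub>Q\<^esub> (\<Otimes>\<^bsub>Q\<^esub>i\<in>I. coset (a i) [^]\<^bsub>Q\<^esub> c i)"
      using insert by (intro Q.finprod_insert) (auto intro!: Q.int_pow_closed coset_in_carrier)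
    also have "\<dots> = coset (frag_cmul (c i) (a i)) \<otimes>\<^bsub>Q\<^esub> coset (\<Sum>i\<in>I. frag_cmul (c i) (a i))"
      using insert pow by auto
    also have "\<dots> = coset (frag_cmul (c i) (a i) \<otimes>\<^bsub>C\<^esub> (\<Sum>i\<in>I. frag_cmul (c i) (a i)))"
      using hom_mult[OF coset_hom, of "frag_cmul (c i) (a i)"] sum aZ by simp
    also have "\<dots> = coset (\<Sum>i\<in>insert i I. frag_cmul (c i) (a i))"
      using insert.hyps by simp
    finally show ?case .
  qed
qed

lemma int_independent_imp_indep_mod:
  assumes "int_independent Q A"
  obtains a where "a ` A \<subseteq> Z" "indep_mod B A a"
proof -
  have "\<forall>x\<in>A. \<exists>z\<in>Z. x = coset z"
    using assms by (auto simp: int_independent_def carrier_Q)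
  then obtain a where a: "\<And>x. x \<in> A \<Longrightarrow> a x \<in> Z \<and> x = coset (a x)" by metis
  have fin: "finite A" using assms by (simp add: int_independent_def)
  have "indep_mod B A a"
    unfolding indep_mod_def
  proof (intro conjI allI impI)
    fix c assume c: "(\<Sum>i\<in>A. frag_cmul (c i) (a i)) \<in> B"
    have "(\<Otimes>\<^bsub>Q\<^esub>x\<in>A. x [^]\<^bsub>Q\<^esub> c x) = (\<Otimes>\<^bsub>Q\<^esub>x\<in>A. coset (a x) [^]\<^bsub>Q\<^esub> c x)"
      using a by (intro Q.finprod_cong') (auto intro!: Q.int_pow_closed coset_in_carrier)
    also have "\<dots> = coset (\<Sum>i\<in>A. frag_cmul (c i) (a i))"
      using fin a by (intro finprod_coset) auto
    also have "\<dots> = \<one>\<^bsub>Q\<^esub>" using c coset_eq_one_iff BZ by blast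
    finally show "\<forall>i\<in>A. c i = 0" using assms by (auto simp: int_independent_def)
  qed (rule fin)
  with a show ?thesis using that[of a] by blast
qed

text \<open>\<open>int_independent\<close> speaks of sets, so different indices must give different
  cosets: if two agreed, the difference of their representatives would be a nontrivial relation
  modulo \<open>B\<close>.\<close>

lemma indep_mod_imp_int_independent:
  assumes ind: "indep_mod B I a" and a: "a ` I \<subseteq> Z"
  shows "int_independent Q ((\<lambda>i. coset (a i)) ` I)" "card ((\<lambda>i. coset (a i)) ` I) = card I"
proof -
  have fin: "finite I" using ind by (simp add: indep_mod_def)
  have inj: "inj_on (\<lambda>i. coset (a i)) I"
  proof (rule inj_onI, rule ccontr)
    fix i j assume ij: "i \<in> I" "j \<in> I" "coset (a i) = coset (a j)" "i \<noteq> j"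
    have "a i \<in> coset (a j)"
      using C.rcos_self[of "a i" B] ij a subgroup_B by (auto simp: coset_def)
    then have "a i - a j \<in> B"
      by (auto simp: coset_def r_coset_def)
    moreover have "(\<Sum>k\<in>I. frag_cmul (if k = i then 1 else if k = j then -1 else 0) (a k))
        = (\<Sum>k\<in>{i, j}. frag_cmul (if k = i then 1 else if k = j then -1 else 0) (a k))"
      using fin ij by (intro sum.mono_neutral_right) auto
    ultimately have "(if i = i then 1 else if i = j then -1 else 0) = (0::int)"
      using ij by (intro indep_modD[OF ind, of "\<lambda>k. if k = i then 1 else if k = j then -1 else 0" i]) auto
    then show False by simp
  qed
  show "card ((\<lambda>i. coset (a i)) ` I) = card I"
    by (rule card_image[OF inj])
  show "int_independent Q ((\<lambda>i. coset (a i)) ` I)"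
    unfolding int_independent_def
  proof (intro conjI allI impI)
    show "finite ((\<lambda>i. coset (a i)) ` I)" using fin by simp
    show "(\<lambda>i. coset (a i)) ` I \<subseteq> carrier Q" using a by (auto simp: carrier_Q)
    fix c
    assume "(\<Otimes>\<^bsub>Q\<^esub>x\<in>(\<lambda>i. coset (a i)) ` I. x [^]\<^bsub>Q\<^esub> (c x :: int)) = \<one>\<^bsub>Q\<^esub>"
    also have "(\<Otimes>\<^bsub>Q\<^esub>x\<in>(\<lambda>i. coset (a i)) ` I. x [^]\<^bsub>Q\<^esub> c x)
        = (\<Otimes>\<^bsub>Q\<^esub>i\<in>I. coset (a i) [^]\<^bsub>Q\<^esub> c (coset (a i)))"
      using inj a by (intro Q.finprod_reindex) (auto intro!: Q.int_pow_closed coset_in_carrier)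
    also have "\<dots> = coset (\<Sum>i\<in>I. frag_cmul (c (coset (a i))) (a i))"
      using fin a by (rule finprod_coset)
    finally have "(\<Sum>i\<in>I. frag_cmul (c (coset (a i))) (a i)) \<in> B"
      using a Z by (subst (asm) coset_eq_one_iff) (auto intro!: frag.subspace_sum frag.subspace_scale)
    then show "\<forall>x\<in>(\<lambda>i. coset (a i)) ` I. c x = 0"
      using indep_modD[OF ind] by auto
  qed
qed

text \<open>Bounds the cardinalities whose \<open>Sup\<close> is the rank; on an unbounded set of
  naturals \<open>Sup\<close> would say nothing.\<close>

lemma int_independent_card_le:
  assumes "finite K" "\<And>z. z \<in> Z \<Longrightarrow> Poly_Mapping.keys z \<subseteq> K" "int_independent Q A"
  shows "card A \<le> card K"
proof -
  obtain a where "a ` A \<subseteq> Z" "indep_mod B A a"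
    by (rule int_independent_imp_indep_mod[OF assms(3)])
  then show ?thesis
    using assms(1,2) B by (intro indep_mod_card_le[of B A a]) (auto simp: frag.subspace_0)
qed

lemma int_independent_empty: "int_independent Q {}"
  by (simp add: int_independent_def)

lemma group_rank_le:
  assumes "finite K" "\<And>z. z \<in> Z \<Longrightarrow> Poly_Mapping.keys z \<subseteq> K"
  shows "group_rank Q \<le> card K"
  unfolding group_rank_def
  using int_independent_empty int_independent_card_le[OF assms] by (intro cSup_least) auto

lemma le_group_rank:
  assumes "finite K" "\<And>z. z \<in> Z \<Longrightarrow> Poly_Mapping.keys z \<subseteq> K" "indep_mod B I a" "a ` I \<subseteq> Z"
  shows "card I \<le> group_rank Q"
  unfolding group_rank_def
proof (rule cSup_upper)
  show "card I \<in> {card A |A. int_independent Q A}"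
    using indep_mod_imp_int_independent[OF assms(3,4)] by (auto intro!: exI[of _ "(\<lambda>i. coset (a i)) ` I"])
  show "bdd_above {card A |A. int_independent Q A}"
    using int_independent_card_le[OF assms(1,2)] by (auto simp: bdd_above_def)
qed

lemma group_rank_eq_0:
  assumes "Z \<subseteq> B"
  shows "group_rank Q = 0"
proof -
  have "card A = 0" if A: "int_independent Q A" for A
  proof -
    obtain a where a: "a ` A \<subseteq> Z" "indep_mod B A a"
      by (rule int_independent_imp_indep_mod[OF A])
    \<comment> \<open>With all coefficients 1, any family in \<open>Z\<close> satisfies a relation
      modulo \<open>B\<close>, so only the empty one is independent.\<close>
    have "(\<Sum>i\<in>A. frag_cmul 1 (a i)) \<in> B"
      using a(1) assms B by (intro frag.subspace_sum frag.subspace_scale) auto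
    then have "A = {}" using indep_modD[OF a(2), of "\<lambda>_. 1"] by fastforce
    then show ?thesis by simp
  qed
  then have "{card A |A. int_independent Q A} = {0}"
    using int_independent_empty by (auto intro!: exI[of _ "{}"])
  then show ?thesis by (simp add: group_rank_def)
qed

end

section \<open>The first path homology group\<close>

definition fillable_paths :: "'v pair_pre_digraph \<Rightarrow> ('v \<times> 'v \<times> 'v) set" where
  "fillable_paths G = {(u, v, w). (u, v) \<in> parcs G \<and> (v, w) \<in> parcs G \<and>
     (u = w \<or> (u, w) \<in> parcs G \<or> (\<exists>v'. v' \<noteq> v \<and> (u, v') \<in> parcs G \<and> (v', w) \<in> parcs G))}"

text \<open>
  The parameter \<open>\<epsilon>\<close> is 1 for the non-regular and 0 for the regular boundary map.
\<close>

locale path_complex = pair_digraph G for G :: "'v pair_pre_digraph" +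
  fixes D :: "('v list \<Rightarrow>\<^sub>0 int) \<Rightarrow> ('v list \<Rightarrow>\<^sub>0 int)" and \<epsilon> :: int
  assumes D_add: "D (x + y) = D x + D y"
    and D_cmul: "D (frag_cmul k x) = frag_cmul k (D x)"
    and D_arc: "D (frag_of [u, v]) = frag_of [v] - frag_of [u]"
    and D_path2: "u \<noteq> v \<Longrightarrow> v \<noteq> w \<Longrightarrow> D (frag_of [u, v, w]) =
      frag_of [v, w] - frag_cmul (if u = w then \<epsilon> else 1) (frag_of [u, w]) + frag_of [u, v]"
begin

section \<open>The complex in degrees 1 and 2\<close>

lemma module_hom_D: "module_hom frag_cmul frag_cmul D"
  by unfold_locales (simp_all add: D_add D_cmul)

lemmas D_zero = module_hom.zero[OF module_hom_D]
  and D_diff = module_hom.diff[OF module_hom_D]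
  and D_sum = module_hom.sum[OF module_hom_D]

lemma no_loop: "(u, v) \<in> parcs G \<Longrightarrow> u \<noteq> v"
  using pair_no_loops by fastforce

lemma allowed_seqs_1: "allowed_seqs G 1 = (\<lambda>e. [fst e, snd e]) ` parcs G"
proof -
  have "length xs = 2 \<longleftrightarrow> (\<exists>u v. xs = [u, v])" for xs :: "'v list"
    by (auto simp: length_Suc_conv numeral_2_eq_2)
  moreover have "int (length xs) = 1 + 1 \<longleftrightarrow> length xs = 2" for xs :: "'v list" by auto
  ultimately show ?thesis
    by (force simp: allowed_seqs_def intro: in_arcsD1 in_arcsD2)
qed

lemma allowed_seqs_2:
  "allowed_seqs G 2 = {[u, v, w] |u v w. (u, v) \<in> parcs G \<and> (v, w) \<in> parcs G}"
proof -
  have "length xs = 3 \<longleftrightarrow> (\<exists>u v w. xs = [u, v, w])" for xs :: "'v list"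
    by (auto simp: length_Suc_conv numeral_3_eq_3)
  moreover have "int (length xs) = 2 + 1 \<longleftrightarrow> length xs = 3" for xs :: "'v list" by auto
  ultimately show ?thesis
    by (auto simp: allowed_seqs_def intro: in_arcsD1 in_arcsD2)
qed

lemma finite_allowed_seqs_1: "finite (allowed_seqs G 1)"
  and card_allowed_seqs_1: "card (allowed_seqs G 1) = card (parcs G)"
  unfolding allowed_seqs_1 using pair_finite_arcs
  by (auto intro!: card_image inj_onI simp: prod_eq_iff)

lemma path_cycles_1: "path_cycles D G 1 = {c. Poly_Mapping.keys c \<subseteq> allowed_seqs G 1 \<and> D c = 0}"
  by (auto simp: path_cycles_def invariant_chains_def allowed_chains_def)

lemma invariant_chains_2: "invariant_chains D G 2 =
    {c. Poly_Mapping.keys c \<subseteq> allowed_seqs G 2 \<and> Poly_Mapping.keys (D c) \<subseteq> allowed_seqs G 1}"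
  by (auto simp: invariant_chains_def allowed_chains_def)

abbreviation "boundaries \<equiv> D ` invariant_chains D G 2"

lemma D_D_eq_0:
  assumes "Poly_Mapping.keys c \<subseteq> allowed_seqs G 2"
  shows "D (D c) = 0"
  using assms
proof (induction c rule: free_Abelian_group_induct[consumes 1, case_names zero diff gen])
  case (gen xs)
  then obtain u v w where "xs = [u, v, w]" "u \<noteq> v" "v \<noteq> w"
    by (auto simp: allowed_seqs_2 dest: no_loop)
  \<comment> \<open>For \<open>u = w\<close> the middle face \<open>[u, u]\<close> has zero boundary
    by \<open>D_arc\<close>, for either value of \<epsilon>.\<close>
  then show ?case
    by (cases "u = w") (simp_all add: D_path2 D_add D_diff D_cmul D_arc)
qed (simp_all add: D_zero D_diff)

lemma subspace_keys: "frag.subspace {x. Poly_Mapping.keys x \<subseteq> K}"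
  by (auto simp: frag.subspace_def dest: subsetD[OF keys_add])

lemma subspace_invariant_chains: "frag.subspace (invariant_chains D G 2)"
proof -
  have "frag.subspace ({c. Poly_Mapping.keys c \<subseteq> allowed_seqs G 2} \<inter>
      (D -` {c. Poly_Mapping.keys c \<subseteq> allowed_seqs G 1}))"
    by (intro frag.subspace_inter subspace_keys module_hom.subspace_vimage[OF module_hom_D])
  then show ?thesis by (simp add: invariant_chains_2 vimage_def Collect_conj_eq)
qed

sublocale H: frag_quotient "allowed_seqs G 1" "path_cycles D G 1" boundaries
proof
  have "frag.subspace ({c. Poly_Mapping.keys c \<subseteq> allowed_seqs G 1} \<inter> (D -` {0}))"
    by (intro frag.subspace_inter subspace_keys module_hom.subspace_vimage[OF module_hom_D]
        frag.subspace_single_0)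
  then show "frag.subspace (path_cycles D G 1)"
    by (simp add: path_cycles_1 vimage_def Collect_conj_eq)
  show "frag.subspace boundaries"
    by (rule module_hom.subspace_image[OF module_hom_D subspace_invariant_chains])
  show "boundaries \<subseteq> path_cycles D G 1"
    by (auto simp: path_cycles_1 invariant_chains_2 D_D_eq_0)
  show "path_cycles D G 1 \<subseteq> carrier (free_Abelian_group (allowed_seqs G 1))"
    by (auto simp: path_cycles_1)
qed

abbreviation "betti1 \<equiv> group_rank (path_homology_group D G 1)"

lemma path_homology_group_1: "path_homology_group D G 1 = H.Q"
  by (simp add: path_homology_group_def)

lemma betti1_le_card_arcs: "betti1 \<le> card (parcs G)"
  using H.group_rank_le[OF finite_allowed_seqs_1]
  by (simp add: path_homology_group_1 path_cycles_1 card_allowed_seqs_1)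

text \<open>The outer faces of an allowed path are arcs, so a non-arc with distinct ends arises only
  as a middle face, once for each midpoint.\<close>

lemma lookup_D_path2:
  assumes "Poly_Mapping.keys c \<subseteq> allowed_seqs G 2" "u \<noteq> w" "(u, w) \<notin> parcs G"
  shows "Poly_Mapping.lookup (D c) [u, w] = - (\<Sum>v\<in>pverts G. Poly_Mapping.lookup c [u, v, w])"
  using assms(1)
proof (induction c rule: free_Abelian_group_induct[consumes 1, case_names zero diff gen])
  case (gen xs)
  then obtain a b d where xs: "xs = [a, b, d]" "(a, b) \<in> parcs G" "(b, d) \<in> parcs G"
    by (auto simp: allowed_seqs_2)
  have b: "b \<in> pverts G" using xs in_arcsD1 by blast
  have "(\<Sum>v\<in>pverts G. Poly_Mapping.lookup (frag_of xs) [u, v, w])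
      = (\<Sum>v\<in>pverts G. if v = b then if u = a \<and> w = d then 1 else 0 else 0)"
    by (intro sum.cong) (auto simp: xs)
  also have "\<dots> = (if u = a \<and> w = d then 1 else 0)"
    using b pair_finite_verts by simp
  finally show ?case
    using xs assms(2,3) no_loop[OF xs(2)] no_loop[OF xs(3)]
    by (auto simp: xs(1) D_path2 lookup_add lookup_minus)
qed (simp_all add: D_zero D_diff lookup_minus sum_subtractf)

text \<open>A path outside \<open>fillable_paths\<close> is the only allowed one of its length
  between its ends, and these form a non-arc. Nothing can cancel its middle face in
  \<open>D c\<close>.\<close>

lemma keys_invariant_chain:
  assumes "c \<in> invariant_chains D G 2"
  shows "Poly_Mapping.keys c \<subseteq> (\<lambda>(u, v, w). [u, v, w]) ` fillable_paths G"
proof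
  fix xs assume xs: "xs \<in> Poly_Mapping.keys c"
  have c: "Poly_Mapping.keys c \<subseteq> allowed_seqs G 2" "Poly_Mapping.keys (D c) \<subseteq> allowed_seqs G 1"
    using assms by (auto simp: invariant_chains_2)
  obtain u v w where uvw: "xs = [u, v, w]" "(u, v) \<in> parcs G" "(v, w) \<in> parcs G"
    using xs c(1) by (auto simp: allowed_seqs_2)
  have "(u, v, w) \<in> fillable_paths G"
  proof (rule ccontr)
    assume "(u, v, w) \<notin> fillable_paths G"
    then have *: "u \<noteq> w" "(u, w) \<notin> parcs G"
      "\<And>v'. v' \<noteq> v \<Longrightarrow> \<not> ((u, v') \<in> parcs G \<and> (v', w) \<in> parcs G)"
      using uvw by (auto simp: fillable_paths_def)
    have "Poly_Mapping.lookup (D c) [u, w] = - (\<Sum>x\<in>pverts G. Poly_Mapping.lookup c [u, x, w])"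
      by (rule lookup_D_path2[OF c(1) *(1,2)])
    also have "(\<Sum>x\<in>pverts G. Poly_Mapping.lookup c [u, x, w])
        = (\<Sum>x\<in>{v}. Poly_Mapping.lookup c [u, x, w])"
    proof (rule sum.mono_neutral_right)
      show "\<forall>x\<in>pverts G - {v}. Poly_Mapping.lookup c [u, x, w] = 0"
        using c(1) *(3) by (fastforce simp: allowed_seqs_2 in_keys_iff)
    qed (use pair_finite_verts uvw in_arcsD1 in auto)
    finally have "[u, w] \<in> Poly_Mapping.keys (D c)"
      using xs by (simp add: uvw in_keys_iff)
    then show False using c(2) *(2) by (auto simp: allowed_seqs_1)
  qed
  then show "xs \<in> (\<lambda>(u, v, w). [u, v, w]) ` fillable_paths G"
    using uvw by force
qed

lemma finite_fillable_paths: "finite (fillable_paths G)"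
  by (rule finite_subset[of _ "pverts G \<times> pverts G \<times> pverts G"])
     (auto simp: fillable_paths_def pair_finite_verts intro: in_arcsD1 in_arcsD2)

section \<open>The Betti number compared with the number of arcs\<close>

lemma chain_eq_sum: "c = (\<Sum>xs\<in>Poly_Mapping.keys c. frag_cmul (Poly_Mapping.lookup c xs) (frag_of xs))"
  for c :: "'v list \<Rightarrow>\<^sub>0 int"
  using frag_expansion[of c] by (simp add: frag_extend_def)

text \<open>A single fillable path need not be an invariant chain, so the span may exceed the
  boundaries. For a lower bound on the rank this is harmless: independence modulo the span implies
  independence modulo the boundaries.\<close>

lemma boundaries_subset_span:
  "boundaries \<subseteq> frag.span ((\<lambda>(u, v, w). D (frag_of [u, v, w])) ` fillable_paths G)"
proof
  fix z assume "z \<in> boundaries"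
  then obtain c where c: "c \<in> invariant_chains D G 2" "z = D c" by auto
  have "D c = (\<Sum>xs\<in>Poly_Mapping.keys c. frag_cmul (Poly_Mapping.lookup c xs) (D (frag_of xs)))"
    by (subst (1) chain_eq_sum[of c]) (simp only: D_sum D_cmul)
  also have "\<dots> \<in> frag.span ((\<lambda>(u, v, w). D (frag_of [u, v, w])) ` fillable_paths G)"
    using keys_invariant_chain[OF c(1)]
    by (intro frag.span_sum frag.span_scale frag.span_base) force
  finally show "z \<in> frag.span ((\<lambda>(u, v, w). D (frag_of [u, v, w])) ` fillable_paths G)"
    by (simp add: c)
qed

lemma arc_chain_eq_sum:
  assumes "Poly_Mapping.keys z \<subseteq> allowed_seqs G 1"
  shows "z = (\<Sum>(u, v)\<in>parcs G. frag_cmul (Poly_Mapping.lookup z [u, v]) (frag_of [u, v]))"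
proof -
  have "z = (\<Sum>xs\<in>allowed_seqs G 1. frag_cmul (Poly_Mapping.lookup z xs) (frag_of xs))"
    by (subst (1) chain_eq_sum, rule sum.mono_neutral_left)
       (use assms finite_allowed_seqs_1 in \<open>auto simp: in_keys_iff\<close>)
  also have "\<dots> = (\<Sum>(u, v)\<in>parcs G. frag_cmul (Poly_Mapping.lookup z [u, v]) (frag_of [u, v]))"
    unfolding allowed_seqs_1
    by (subst sum.reindex) (auto intro!: inj_onI sum.cong simp: prod_eq_iff)
  finally show ?thesis .
qed

lemma D_arc_chain:
  assumes "Poly_Mapping.keys z \<subseteq> allowed_seqs G 1"
  shows "D z = (\<Sum>(u, v)\<in>parcs G. frag_cmul (Poly_Mapping.lookup z [u, v]) (frag_of [v] - frag_of [u]))"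
  by (subst arc_chain_eq_sum[OF assms], subst D_sum) (auto intro!: sum.cong simp: D_cmul D_arc)

text \<open>The single arcs form an independent family. Lying in the kernel of \<open>D\<close> is
  one condition per vertex, and the span containing the boundaries has at most one generator per
  fillable path; each costs at most one member.\<close>

lemma card_arcs_le_betti1:
  "card (parcs G) \<le> betti1 + card (pverts G) + card (fillable_paths G)"
proof -
  define h where "h v x = Poly_Mapping.lookup (D x) [v]" for v x
  have h: "h k (x + y) = h k x + h k y" "h k (frag_cmul m x) = m * h k x" for k x y m
    by (simp_all add: h_def D_add D_cmul lookup_add)
  obtain J :: "'v list set" and a where J: "card (allowed_seqs G 1) \<le> card J + card (pverts G)" "indep_mod {0} J a"
    "a ` J \<subseteq> {x \<in> {x. Poly_Mapping.keys x \<subseteq> allowed_seqs G 1}. \<forall>v\<in>pverts G. h v x = 0}"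
    by (rule indep_mod_kernel[where h = h, OF pair_finite_verts
          indep_mod_frag_of[OF finite_allowed_seqs_1] _ subspace_keys[of "allowed_seqs G 1"] h]) auto
  have "x \<in> path_cycles D G 1"
    if "Poly_Mapping.keys x \<subseteq> allowed_seqs G 1" "\<forall>v\<in>pverts G. h v x = 0" for x
  proof -
    \<comment> \<open>The functionals test only the sequences \<open>[v]\<close> with
      \<open>v\<close> a vertex; as \<open>D x\<close> contains no others, their vanishing gives
      \<open>D x = 0\<close>.\<close>
    have "Poly_Mapping.keys (D x) \<subseteq> (\<lambda>v. [v]) ` pverts G"
      unfolding D_arc_chain[OF that(1)]
      by (rule order.trans[OF keys_sum])
         (auto dest!: subsetD[OF keys_diff] dest: in_arcsD1 in_arcsD2)
    moreover have "[v] \<notin> Poly_Mapping.keys (D x)" if "v \<in> pverts G" for v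
      using \<open>\<forall>v\<in>pverts G. h v x = 0\<close> that by (simp add: h_def in_keys_iff)
    ultimately have "Poly_Mapping.keys (D x) = {}" by blast
    then have "D x = 0" by simp
    then show ?thesis using that(1) by (simp add: path_cycles_1)
  qed
  then have aZ: "a ` J \<subseteq> path_cycles D G 1" using J(3) by auto
  obtain J' where J': "J' \<subseteq> J"
    "card J \<le> card J' + card ((\<lambda>(u, v, w). D (frag_of [u, v, w])) ` fillable_paths G)"
    "indep_mod (frag.span ((\<lambda>(u, v, w). D (frag_of [u, v, w])) ` fillable_paths G)) J' a"
    by (rule indep_mod_span[OF finite_imageI[OF finite_fillable_paths] J(2)])
  have "card J' \<le> betti1"
    unfolding path_homology_group_1
    using aZ J'(1)
    by (intro H.le_group_rank[OF finite_allowed_seqs_1 _ indep_mod_mono[OF J'(3) boundaries_subset_span]])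
       (auto simp: path_cycles_1)
  moreover have "card ((\<lambda>(u, v, w). D (frag_of [u, v, w])) ` fillable_paths G) \<le> card (fillable_paths G)"
    by (rule card_image_le[OF finite_fillable_paths])
  ultimately show ?thesis using J(1) J'(2) by (simp add: card_allowed_seqs_1)
qed

lemma betti1_eq_0:
  "path_cycles D G 1 \<subseteq> boundaries \<Longrightarrow> betti1 = 0"
  unfolding path_homology_group_1 by (rule H.group_rank_eq_0)

text \<open>
  The support of a cycle has minimum degree at least 2, hence at least as many arcs as vertices.
\<close>

lemma nonzero_cycle_dense_support:
  assumes "betti1 \<noteq> 0"
  obtains U S where "U \<subseteq> pverts G" "U \<noteq> {}" "S \<subseteq> parcs G" "S \<subseteq> U \<times> U" "card S = card U"
proof -
  have "0 \<in> boundaries"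
    using frag.subspace_0[OF H.B] .
  then obtain z where z: "z \<in> path_cycles D G 1" "z \<noteq> 0"
    using assms betti1_eq_0 by force
  define S where "S = {(u, v). Poly_Mapping.lookup z [u, v] \<noteq> 0}"
  define U where "U = fst ` S \<union> snd ` S"
  have zk: "Poly_Mapping.keys z \<subseteq> allowed_seqs G 1" "D z = 0"
    using z by (auto simp: path_cycles_1)
  have SG: "S \<subseteq> parcs G"
    using zk(1) by (fastforce simp: S_def allowed_seqs_1 in_keys_iff)
  then have fin: "finite S" using pair_finite_arcs finite_subset by blast
  \<comment> \<open>With a single incident arc in the support, the coefficient of \<open>[x]\<close>
    in \<open>D z\<close> would be that of the arc up to sign, hence nonzero.\<close>
  have deg: "card {e \<in> S. fst e = x \<or> snd e = x} \<ge> 2" if x: "x \<in> U" for x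
  proof (rule ccontr)
    assume less: "\<not> 2 \<le> card {e \<in> S. fst e = x \<or> snd e = x}"
    obtain a b where ab: "(a, b) \<in> S" "x = a \<or> x = b" using x unfolding U_def by force
    then have "{(a, b)} \<subseteq> {e \<in> S. fst e = x \<or> snd e = x}" by auto
    then have one: "{e \<in> S. fst e = x \<or> snd e = x} = {(a, b)}"
      using less fin by (intro card_seteq[symmetric]) auto
    define f where "f = (\<lambda>(u, v). Poly_Mapping.lookup z [u, v] *
      ((if x = v then 1 else 0) - (if x = u then 1 else 0)))"
    have "0 = Poly_Mapping.lookup (D z) [x]" by (simp add: zk)
    also have "\<dots> = sum f (parcs G)"
      unfolding D_arc_chain[OF zk(1)] lookup_sum f_def
      by (intro sum.cong) (auto simp: lookup_minus)
    also have "\<dots> = sum f {(a, b)}"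
    proof (rule sum.mono_neutral_right)
      show "\<forall>e\<in>parcs G - {(a, b)}. f e = 0"
      proof
        fix e assume "e \<in> parcs G - {(a, b)}"
        then have "e \<notin> {e \<in> S. fst e = x \<or> snd e = x}" by (simp only: one) simp
        then show "f e = 0" by (cases e) (auto simp: f_def S_def)
      qed
    qed (use pair_finite_arcs ab SG in auto)
    also have "\<dots> \<noteq> 0"
      using ab no_loop[of a b] SG by (auto simp: f_def S_def)
    finally show False by simp
  qed
  have finU: "finite U" using fin by (simp add: U_def)
  \<comment> \<open>Incidences between \<open>U\<close> and \<open>S\<close> are counted twice: at
    least two at each vertex, at most two on each arc.\<close>
  have "2 * card U = (\<Sum>x\<in>U. 2)" by simp
  also have "\<dots> \<le> (\<Sum>x\<in>U. card {e \<in> S. fst e = x \<or> snd e = x})"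
    using deg by (rule sum_mono)
  also have "\<dots> = (\<Sum>x\<in>U. \<Sum>e | e \<in> S \<and> (fst e = x \<or> snd e = x). 1)"
    by simp
  also have "\<dots> = (\<Sum>e\<in>S. \<Sum>x | x \<in> U \<and> (fst e = x \<or> snd e = x). 1)"
    by (rule sum.swap_restrict[OF finU fin])
  also have "\<dots> \<le> (\<Sum>e\<in>S. 2)"
  proof (rule sum_mono)
    fix e :: "'v \<times> 'v"
    have "card {x. x \<in> U \<and> (fst e = x \<or> snd e = x)} \<le> card {fst e, snd e}"
      by (intro card_mono) auto
    also have "\<dots> \<le> 2" by (simp add: card_insert_if)
    finally show "(\<Sum>x | x \<in> U \<and> (fst e = x \<or> snd e = x). 1) \<le> (2::nat)" by simp
  qed
  finally have "card U \<le> card S" by simp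
  \<comment> \<open>Keeping exactly \<open>card U\<close> arcs leaves a single size of arc set for
    each vertex set in the union bound.\<close>
  then obtain S' where S': "S' \<subseteq> S" "card S' = card U"
    by (metis obtain_subset_with_card_n)
  have "\<exists>u v. Poly_Mapping.lookup z [u, v] \<noteq> 0"
  proof (rule ccontr)
    assume "\<nexists>u v. Poly_Mapping.lookup z [u, v] \<noteq> 0"
    then have "z = 0" by (subst arc_chain_eq_sum[OF zk(1)]) auto
    with z(2) show False by simp
  qed
  then have "U \<noteq> {}" by (auto simp: U_def S_def)
  moreover have "S \<subseteq> U \<times> U" by (force simp: U_def)
  moreover have "U \<subseteq> pverts G" using SG arc_fst_in_verts arc_snd_in_verts unfolding U_def by blast
  ultimately show ?thesis using that[of U S'] S' SG by blast
qed

section \<open>Filling cycles with triangles and squares\<close>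

lemma triangle_boundary:
  assumes "(x, a) \<in> parcs G" "(x, b) \<in> parcs G" "(a, b) \<in> parcs G"
  shows "frag_of [a, b] - frag_of [x, b] + frag_of [x, a] \<in> boundaries"
proof
  show D: "frag_of [a, b] - frag_of [x, b] + frag_of [x, a] = D (frag_of [x, a, b])"
    using assms by (simp add: D_path2 no_loop)
  have "Poly_Mapping.keys (frag_of [a, b] - frag_of [x, b] + frag_of [x, a])
      \<subseteq> {[a, b], [x, b], [x, a]}"
    using keys_add[of "frag_of [a, b] - frag_of [x, b]" "frag_of [x, a]"]
      keys_diff[of "frag_of [a, b]" "frag_of [x, b]"] by auto
  also have "\<dots> \<subseteq> allowed_seqs G 1"
    using assms by (force simp: allowed_seqs_1)
  finally show "frag_of [x, a, b] \<in> invariant_chains D G 2"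
    using assms by (auto simp: invariant_chains_2 D allowed_seqs_2)
qed

text \<open>The two paths have the same middle face \<open>[k, a]\<close>, which may be a non-arc or
  degenerate; it cancels in the difference with the same coefficient, which makes the difference
  invariant.\<close>

lemma square_boundary:
  assumes "(k, x) \<in> parcs G" "(k, y) \<in> parcs G" "(x, a) \<in> parcs G" "(y, a) \<in> parcs G"
  shows "(frag_of [x, a] + frag_of [k, x]) - (frag_of [y, a] + frag_of [k, y]) \<in> boundaries"
proof
  show D: "(frag_of [x, a] + frag_of [k, x]) - (frag_of [y, a] + frag_of [k, y])
      = D (frag_of [k, x, a] - frag_of [k, y, a])"
    using assms by (simp add: D_path2 D_diff no_loop)
  have "Poly_Mapping.keys ((frag_of [x, a] + frag_of [k, x]) - (frag_of [y, a] + frag_of [k, y]))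
      \<subseteq> {[x, a], [k, x], [y, a], [k, y]}"
    using keys_diff[of "frag_of [x, a] + frag_of [k, x]" "frag_of [y, a] + frag_of [k, y]"]
      keys_add[of "frag_of [x, a]" "frag_of [k, x]"] keys_add[of "frag_of [y, a]" "frag_of [k, y]"]
    by auto
  also have "\<dots> \<subseteq> allowed_seqs G 1"
    using assms by (force simp: allowed_seqs_1)
  finally show "frag_of [k, x, a] - frag_of [k, y, a] \<in> invariant_chains D G 2"
    using assms keys_diff[of "frag_of [k, x, a]" "frag_of [k, y, a]"]
    by (auto simp: invariant_chains_2 allowed_seqs_2 simp flip: D)
qed

text \<open>
  Modulo boundaries, the chain \<open>[x, b] - [x, a]\<close> does not depend on the choice of the common
  in-neighbour \<open>x\<close> of \<open>a\<close> and \<open>b\<close>. Coning off from common in-neighbours therefore turns every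
  arc into a difference of potentials.
\<close>

lemma betti1_eq_0_if_common_in_neighbours:
  assumes nbr: "\<And>a b c. \<lbrakk>a \<in> pverts G; b \<in> pverts G; c \<in> pverts G\<rbrakk> \<Longrightarrow>
      \<exists>x. (x, a) \<in> parcs G \<and> (x, b) \<in> parcs G \<and> (x, c) \<in> parcs G"
  shows "betti1 = 0"
proof (rule betti1_eq_0, rule subsetI)
  fix z assume "z \<in> path_cycles D G 1"
  then have z: "Poly_Mapping.keys z \<subseteq> allowed_seqs G 1" "D z = 0"
    by (auto simp: path_cycles_1)
  let ?B = boundaries
  have swap: "frag_of [x, a] - frag_of [y, a] - (frag_of [x, b] - frag_of [y, b]) \<in> ?B"
    if xy: "(x, a) \<in> parcs G" "(y, a) \<in> parcs G" "(x, b) \<in> parcs G" "(y, b) \<in> parcs G" for x y a b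
  proof -
    obtain k where k: "(k, x) \<in> parcs G" "(k, y) \<in> parcs G"
      using nbr[of x y y] in_arcsD1[OF xy(1)] in_arcsD1[OF xy(2)] by blast
    \<comment> \<open>The squares from \<open>k\<close> to \<open>a\<close> and from
      \<open>k\<close> to \<open>b\<close> share the arcs \<open>[k, x]\<close> and
      \<open>[k, y]\<close>, which cancel.\<close>
    have "(frag_of [x, a] + frag_of [k, x]) - (frag_of [y, a] + frag_of [k, y])
        - ((frag_of [x, b] + frag_of [k, x]) - (frag_of [y, b] + frag_of [k, y])) \<in> ?B"
      using xy k by (intro frag.subspace_diff[OF H.B] square_boundary)
    then show ?thesis by (simp add: algebra_simps)
  qed
  show "z \<in> ?B"
  proof (cases "pverts G = {}")
    case True
    then have "parcs G = {}" using in_arcsD1 by fastforce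
    then have "z = 0" by (subst arc_chain_eq_sum[OF z(1)]) simp
    then show ?thesis using frag.subspace_0[OF H.B] by simp
  next
    case False
    then obtain r where r: "r \<in> pverts G" by auto
    obtain X where X: "\<And>v. v \<in> pverts G \<Longrightarrow> (X v, r) \<in> parcs G \<and> (X v, v) \<in> parcs G"
      using nbr[OF r r] by metis
    \<comment> \<open>The potential of \<open>v\<close>: a chain joining the root \<open>r\<close>
      to \<open>v\<close> through \<open>X v\<close>, with boundary
      \<open>[v] - [r]\<close>.\<close>
    define g where "g v = frag_of [X v, v] - frag_of [X v, r]" for v
    have arc: "frag_of [a, b] - (g b - g a) \<in> ?B" if ab: "(a, b) \<in> parcs G" for a b
    proof -
      have V: "a \<in> pverts G" "b \<in> pverts G" using ab in_arcsD1 in_arcsD2 by auto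
      \<comment> \<open>Here all three vertices matter: \<open>x\<close> spans a triangle with the
        arc, and being also an in-neighbour of \<open>r\<close> it can be exchanged for
        \<open>X a\<close> and for \<open>X b\<close> by \<open>swap\<close>.\<close>
      obtain x where x: "(x, r) \<in> parcs G" "(x, a) \<in> parcs G" "(x, b) \<in> parcs G"
        using nbr[OF r V] by auto
      have "(frag_of [a, b] - frag_of [x, b] + frag_of [x, a])
        + (frag_of [x, b] - frag_of [X b, b] - (frag_of [x, r] - frag_of [X b, r]))
        - (frag_of [x, a] - frag_of [X a, a] - (frag_of [x, r] - frag_of [X a, r])) \<in> ?B"
        using ab V X x
        by (intro frag.subspace_diff[OF H.B] frag.subspace_add[OF H.B] triangle_boundary swap) auto
      then show ?thesis by (simp add: g_def algebra_simps)
    qed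
    \<comment> \<open>Extending \<open>g\<close> linearly over the vertices and applying it to
      \<open>D z = 0\<close> shows that the potential differences along \<open>z\<close> sum to 0,
      so subtracting them does not change \<open>z\<close>.\<close>
    have "0 = frag_extend (\<lambda>xs. g (hd xs)) (D z)" by (simp add: z)
    also have "\<dots> = (\<Sum>(u, v)\<in>parcs G. frag_cmul (Poly_Mapping.lookup z [u, v]) (g v - g u))"
      unfolding D_arc_chain[OF z(1)] frag_extend_sum[OF pair_finite_arcs]
      by (intro sum.cong) (auto simp: frag_extend_cmul frag_extend_diff)
    finally have "z = (\<Sum>(u, v)\<in>parcs G. frag_cmul (Poly_Mapping.lookup z [u, v]) (frag_of [u, v]))
        - (\<Sum>(u, v)\<in>parcs G. frag_cmul (Poly_Mapping.lookup z [u, v]) (g v - g u))"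
      using arc_chain_eq_sum[OF z(1)] by simp
    also have "\<dots> = (\<Sum>(u, v)\<in>parcs G. frag_cmul (Poly_Mapping.lookup z [u, v])
        (frag_of [u, v] - (g v - g u)))"
      unfolding sum_subtractf[symmetric]
      by (intro sum.cong) (auto simp: frag.scale_right_diff_distrib)
    also have "\<dots> \<in> ?B"
      using arc by (intro frag.subspace_sum[OF H.B]) (auto intro!: frag.subspace_scale[OF H.B])
    finally show ?thesis .
  qed
qed

end

lemma path_complex_path_boundary:
  assumes "pair_digraph G"
  shows "path_complex G path_boundary 1"
proof -
  interpret pair_digraph G by fact
  show ?thesis
    by unfold_locales
      (simp_all add: path_boundary_def frag_extend_add frag_extend_cmul numeral_2_eq_2 lessThan_Suc)
qed

text \<open>Single vertices survive the projection, and so do the outer faces; only a middle face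
  \<open>[u, u]\<close> is killed, hence \<epsilon> = 0.\<close>

lemma path_complex_reg_path_boundary:
  assumes "pair_digraph G"
  shows "path_complex G reg_path_boundary 0"
proof -
  interpret pair_digraph G by fact
  interpret path_complex G path_boundary 1
    by (rule path_complex_path_boundary[OF assms])
  show ?thesis
  proof
    fix x y :: "'a list \<Rightarrow>\<^sub>0 int" and k
    show "reg_path_boundary (x + y) = reg_path_boundary x + reg_path_boundary y"
      "reg_path_boundary (frag_cmul k x) = frag_cmul k (reg_path_boundary x)"
      by (simp_all add: reg_path_boundary_def reg_proj_def D_add D_cmul frag_extend_add frag_extend_cmul)
  next
    fix u v w :: 'a
    show "reg_path_boundary (frag_of [u, v]) = frag_of [v] - frag_of [u]"
      by (simp add: reg_path_boundary_def reg_proj_def D_arc frag_extend_diff)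
    assume "u \<noteq> v" "v \<noteq> w"
    then show "reg_path_boundary (frag_of [u, v, w]) =
        frag_of [v, w] - frag_cmul (if u = w then 0 else 1) (frag_of [u, w]) + frag_of [u, v]"
      by (simp add: reg_path_boundary_def reg_proj_def D_path2 frag_extend_diff frag_extend_add)
  qed
qed

section \<open>Random digraphs\<close>

lemma finite_possible_arcs: "finite (possible_arcs n)"
  by (rule finite_subset[of _ "{1..n} \<times> {1..n}"]) (auto simp: possible_arcs_def)

lemma card_possible_arcs: "real (card (possible_arcs n)) = real n * (real n - 1)"
proof -
  have "possible_arcs n = {1..n} \<times> {1..n} - (\<lambda>i. (i, i)) ` {1..n}"
    by (auto simp: possible_arcs_def)
  then have "card (possible_arcs n) = n * n - n"
    by (simp add: card_Diff_subset image_subset_iff card_image inj_on_def)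
  then show ?thesis by (simp add: of_nat_diff algebra_simps)
qed

lemma set_pmf_er_digraph:
  assumes "G \<in> set_pmf (er_digraph n p)"
  shows "pverts G = {1..n}" "parcs G \<subseteq> possible_arcs n"
proof -
  obtain f where f: "f \<in> set_pmf (Pi_pmf (possible_arcs n) False (\<lambda>_. bernoulli_pmf p))"
    "G = \<lparr>pverts = {1..n}, parcs = {e. f e}\<rparr>"
    using assms by (auto simp: er_digraph_def)
  then have "f e \<Longrightarrow> e \<in> possible_arcs n" for e
    using set_Pi_pmf_subset[OF finite_possible_arcs, of n False "\<lambda>_. bernoulli_pmf p"] by blast
  then show "pverts G = {1..n}" "parcs G \<subseteq> possible_arcs n" by (auto simp: f(2))
qed

lemma finite_set_pmf_er_digraph: "finite (set_pmf (er_digraph n p))"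
proof (rule finite_subset)
  show "set_pmf (er_digraph n p) \<subseteq>
      (\<lambda>E. \<lparr>pverts = {1..n}, parcs = E\<rparr>) ` Pow (possible_arcs n)"
  proof
    fix G assume "G \<in> set_pmf (er_digraph n p)"
    then have "G = \<lparr>pverts = {1..n}, parcs = parcs G\<rparr>" "parcs G \<in> Pow (possible_arcs n)"
      using set_pmf_er_digraph by auto
    then show "G \<in> (\<lambda>E. \<lparr>pverts = {1..n}, parcs = E\<rparr>) ` Pow (possible_arcs n)" by blast
  qed
qed (simp add: finite_possible_arcs)

lemma pair_digraph_er_digraph:
  assumes "G \<in> set_pmf (er_digraph n p)"
  shows "pair_digraph G"
  using set_pmf_er_digraph[OF assms] finite_subset[OF _ finite_possible_arcs]
  by unfold_locales (auto simp: possible_arcs_def)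

lemma integrable_er_digraph [simp]: "integrable (measure_pmf (er_digraph n p)) (f :: _ \<Rightarrow> real)"
  by (rule integrable_measure_pmf_finite[OF finite_set_pmf_er_digraph])

lemma pmf_expectation_mono:
  fixes f g :: "'a \<Rightarrow> real"
  assumes "finite (set_pmf M)" "\<And>x. x \<in> set_pmf M \<Longrightarrow> f x \<le> g x"
  shows "measure_pmf.expectation M f \<le> measure_pmf.expectation M g"
  using assms by (intro integral_mono_AE integrable_measure_pmf_finite) (auto simp: AE_measure_pmf_iff)

lemma pmf_prob_mono:
  assumes "\<And>x. x \<in> set_pmf M \<Longrightarrow> x \<in> A \<Longrightarrow> x \<in> B"
  shows "measure_pmf.prob M A \<le> measure_pmf.prob M B"
  using assms by (intro measure_pmf.finite_measure_mono_AE) (auto simp: AE_measure_pmf_iff)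

lemma pmf_Markov:
  fixes f :: "'a \<Rightarrow> real"
  assumes "finite (set_pmf M)" "\<And>x. x \<in> set_pmf M \<Longrightarrow> 0 \<le> f x" "c > 0"
  shows "measure_pmf.prob M {x. c \<le> f x} \<le> measure_pmf.expectation M f / c"
proof -
  have "c * measure_pmf.prob M {x. c \<le> f x} = measure_pmf.expectation M (\<lambda>x. c * indicator {x. c \<le> f x} x)"
    by simp
  also have "\<dots> \<le> measure_pmf.expectation M f"
    using assms by (intro pmf_expectation_mono) (auto simp: indicator_def)
  finally show ?thesis using assms(3) by (simp add: field_simps)
qed

section \<open>Arc patterns and the concentration of the number of arcs\<close>

context
  fixes n :: nat and p :: real
  assumes p: "0 \<le> p" "p \<le> 1"
begin

lemma prob_arcs_subset:
  assumes "S \<subseteq> possible_arcs n"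
  shows "measure_pmf.prob (er_digraph n p) {G. S \<subseteq> parcs G} = p ^ card S"
proof -
  have "measure_pmf.prob (er_digraph n p) {G. S \<subseteq> parcs G}
      = measure_pmf.prob (Pi_pmf (possible_arcs n) False (\<lambda>_. bernoulli_pmf p))
          (Pi (possible_arcs n) (\<lambda>e. if e \<in> S then {True} else UNIV))"
    unfolding er_digraph_def measure_map_pmf
    by (rule arg_cong[where f = "measure_pmf.prob _"]) (use assms in \<open>auto simp: Pi_def\<close>)
  also have "\<dots> = (\<Prod>e\<in>possible_arcs n. if e \<in> S then p else 1)"
    using p by (subst measure_Pi_pmf_Pi[OF finite_possible_arcs])
      (auto intro!: prod.cong simp: measure_pmf_single)
  also have "\<dots> = (\<Prod>e\<in>S. p)"
    using assms finite_possible_arcs by (intro prod.mono_neutral_cong_right) auto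
  finally show ?thesis by simp
qed

text \<open>Missing some arc of \<open>S x\<close> is the difference of two events of the same form,
  the second with \<open>S x\<close> added to \<open>T\<close>; this is why \<open>T\<close> varies
  in the induction. Disjointness makes the exponents add.\<close>

lemma prob_arcs_subset_avoiding:
  assumes "finite X" "\<And>x. x \<in> X \<Longrightarrow> S x \<subseteq> possible_arcs n" "disjoint_family_on S X"
    "T \<subseteq> possible_arcs n" "\<And>x. x \<in> X \<Longrightarrow> T \<inter> S x = {}"
  shows "measure_pmf.prob (er_digraph n p) {G. T \<subseteq> parcs G \<and> (\<forall>x\<in>X. \<not> S x \<subseteq> parcs G)}
    = p ^ card T * (\<Prod>x\<in>X. 1 - p ^ card (S x))"
  using assms
proof (induction X arbitrary: T)
  case empty
  then show ?case by (simp add: prob_arcs_subset)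
next
  case (insert x X)
  let ?A = "\<lambda>T. {G :: nat pair_pre_digraph. T \<subseteq> parcs G \<and> (\<forall>x\<in>X. \<not> S x \<subseteq> parcs G)}"
  have disj: "disjoint_family_on S X"
    using insert.prems(2) by (auto simp: disjoint_family_on_def)
  have TS: "T \<inter> S x = {}" "S x \<subseteq> possible_arcs n" using insert.prems by auto
  have "{G. T \<subseteq> parcs G \<and> (\<forall>x\<in>insert x X. \<not> S x \<subseteq> parcs G)} = ?A T - ?A (T \<union> S x)"
    by auto
  then have "measure_pmf.prob (er_digraph n p) {G. T \<subseteq> parcs G \<and> (\<forall>x\<in>insert x X. \<not> S x \<subseteq> parcs G)}
      = measure_pmf.prob (er_digraph n p) (?A T) - measure_pmf.prob (er_digraph n p) (?A (T \<union> S x))"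
    by (simp only:) (rule measure_pmf.finite_measure_Diff, auto)
  also have "measure_pmf.prob (er_digraph n p) (?A T) = p ^ card T * (\<Prod>x\<in>X. 1 - p ^ card (S x))"
    using insert.prems by (intro insert.IH disj) auto
  also have "measure_pmf.prob (er_digraph n p) (?A (T \<union> S x)) = p ^ card (T \<union> S x) * (\<Prod>x\<in>X. 1 - p ^ card (S x))"
  proof (intro insert.IH disj)
    show "(T \<union> S x) \<inter> S y = {}" if "y \<in> X" for y
      using insert.prems(2,4) that insert.hyps(2) by (auto simp: disjoint_family_on_def)
  qed (use insert.prems in auto)
  also have "card (T \<union> S x) = card T + card (S x)"
    using TS insert.prems(3) by (intro card_Un_disjoint) (auto intro: finite_subset[OF _ finite_possible_arcs])
  finally show ?case using insert.hyps by (simp add: power_add algebra_simps)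
qed

text \<open>Arcs, pairs of arcs and fillable paths are all counted as arc patterns contained in the
  digraph; linearity of expectation then needs no independence between patterns.\<close>

lemma expectation_card_arc_patterns:
  assumes "finite I" "\<And>i. i \<in> I \<Longrightarrow> S i \<subseteq> possible_arcs n"
  shows "measure_pmf.expectation (er_digraph n p) (\<lambda>G. real (card {i \<in> I. S i \<subseteq> parcs G})) = (\<Sum>i\<in>I. p ^ card (S i))"
proof -
  have "(\<lambda>G :: nat pair_pre_digraph. real (card {i \<in> I. S i \<subseteq> parcs G}))
      = (\<lambda>G. \<Sum>i\<in>I. indicator {G. S i \<subseteq> parcs G} G)"
    using assms(1) by (auto simp: fun_eq_iff indicator_def sum.If_cases Int_def)
  then have "measure_pmf.expectation (er_digraph n p) (\<lambda>G. real (card {i \<in> I. S i \<subseteq> parcs G}))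
      = (\<Sum>i\<in>I. measure_pmf.prob (er_digraph n p) {G. S i \<subseteq> parcs G})"
    by (simp add: Bochner_Integration.integral_sum)
  then show ?thesis using assms(2) by (simp add: prob_arcs_subset)
qed

lemma expectation_card_arcs:
  "measure_pmf.expectation (er_digraph n p) (\<lambda>G. real (card (parcs G))) = real n * (real n - 1) * p"
proof -
  have "measure_pmf.expectation (er_digraph n p) (\<lambda>G. real (card (parcs G)))
      = measure_pmf.expectation (er_digraph n p) (\<lambda>G. real (card {e \<in> possible_arcs n. {e} \<subseteq> parcs G}))"
    by (intro integral_cong_AE AE_pmfI)
       (auto dest!: set_pmf_er_digraph(2) intro!: arg_cong[where f = card])
  also have "\<dots> = real n * (real n - 1) * p"
    by (subst expectation_card_arc_patterns) (auto simp: finite_possible_arcs card_possible_arcs)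
  finally show ?thesis .
qed

text \<open>The square counts ordered pairs of arcs; a diagonal pair has probability p, any other
  p^2. In this form the bound says that the variance is at most the mean.\<close>

lemma expectation_card_arcs_squared_le:
  "measure_pmf.expectation (er_digraph n p) (\<lambda>G. (real (card (parcs G)))\<^sup>2)
    \<le> real n * (real n - 1) * p + (real n * (real n - 1) * p)\<^sup>2"
proof -
  let ?E = "possible_arcs n"
  have "measure_pmf.expectation (er_digraph n p) (\<lambda>G. (real (card (parcs G)))\<^sup>2)
      = measure_pmf.expectation (er_digraph n p)
          (\<lambda>G. real (card {e \<in> ?E \<times> ?E. {fst e, snd e} \<subseteq> parcs G}))"
  proof (intro integral_cong_AE AE_pmfI)
    fix G assume "G \<in> set_pmf (er_digraph n p)"
    then have "{e \<in> ?E \<times> ?E. {fst e, snd e} \<subseteq> parcs G} = parcs G \<times> parcs G"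
      by (auto dest!: set_pmf_er_digraph(2))
    then show "(real (card (parcs G)))\<^sup>2 = real (card {e \<in> ?E \<times> ?E. {fst e, snd e} \<subseteq> parcs G})"
      by (simp add: card_cartesian_product power2_eq_square)
  qed auto
  also have "\<dots> = (\<Sum>e\<in>?E \<times> ?E. p ^ card {fst e, snd e})"
    by (rule expectation_card_arc_patterns) (auto simp: finite_possible_arcs)
  also have "\<dots> \<le> (\<Sum>e\<in>?E \<times> ?E. (if fst e = snd e then p else 0) + p\<^sup>2)"
    using p by (intro sum_mono) (auto simp: power2_eq_square)
  also have "\<dots> = (\<Sum>a\<in>?E. \<Sum>b\<in>?E. if a = b then p else 0) + real (card (?E \<times> ?E)) * p\<^sup>2"
    by (simp add: sum.distrib sum.cartesian_product case_prod_unfold)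
  also have "(\<Sum>a\<in>?E. \<Sum>b\<in>?E. if a = b then p else 0) = real (card ?E) * p"
    by (simp add: finite_possible_arcs)
  finally show ?thesis
    by (simp add: card_cartesian_product card_possible_arcs power2_eq_square algebra_simps)
qed

lemma prob_few_arcs:
  assumes "0 < real n * (real n - 1) * p"
  shows "measure_pmf.prob (er_digraph n p) {G. real (card (parcs G)) \<le> real n * (real n - 1) * p / 2}
    \<le> 4 / (real n * (real n - 1) * p)"
proof -
  define m where "m = real n * (real n - 1) * p"
  have m: "m > 0" using assms by (simp add: m_def)
  have var: "measure_pmf.variance (er_digraph n p) (\<lambda>G. real (card (parcs G))) \<le> m"
    using expectation_card_arcs_squared_le
    by (subst measure_pmf.variance_eq) (simp_all add: expectation_card_arcs m_def)
  have "measure_pmf.prob (er_digraph n p) {G. real (card (parcs G)) \<le> m / 2}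
      \<le> measure_pmf.prob (er_digraph n p) {G \<in> space (measure_pmf (er_digraph n p)). m / 2 \<le>
          \<bar>real (card (parcs G)) - measure_pmf.expectation (er_digraph n p) (\<lambda>G. real (card (parcs G)))\<bar>}"
    by (intro measure_pmf.finite_measure_mono) (auto simp: expectation_card_arcs m_def[symmetric])
  also have "\<dots> \<le> measure_pmf.variance (er_digraph n p) (\<lambda>G. real (card (parcs G))) / (m / 2)\<^sup>2"
    using m by (intro measure_pmf.Chebyshev_inequality) auto
  also have "\<dots> \<le> m / (m / 2)\<^sup>2"
    using var by (intro divide_right_mono) auto
  also have "\<dots> = 4 / m" using m by (simp add: power2_eq_square field_simps)
  finally show ?thesis by (simp add: m_def)
qed

end

section \<open>Union bounds and expected counts\<close>

text \<open>The left side is one term of the exponential series at k.\<close>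

lemma power_over_fact_le_exp: "real k ^ k / fact k \<le> exp 1 ^ k"
proof -
  have "real k ^ k /\<^sub>R fact k \<le> exp (real k)"
    using sum_le_suminf[of "\<lambda>j. real k ^ j /\<^sub>R fact j" "{k}"] exp_converges[of "real k"]
    by (simp add: sums_iff)
  then show ?thesis by (simp add: exp_of_nat_mult[symmetric] divide_inverse mult.commute)
qed

text \<open>The left side comes from choosing k of n vertices and then k of the k^2 ordered pairs on
  them. The two factorials in the denominators turn k^(2k) into the square of k^k / k!, whence the
  constant e^2.\<close>

lemma choose_square_bound:
  assumes "0 \<le> p"
  shows "real (n choose k) * real (k\<^sup>2 choose k) * p ^ k \<le> ((exp 1)\<^sup>2 * real n * p) ^ k"
proof -
  have c: "real (m choose k) \<le> real m ^ k / fact k" for m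
  proof -
    have "real ((m choose k) * fact k) \<le> real (m ^ k)"
      by (simp only: of_nat_le_iff binomial_fact_pow)
    then show ?thesis by (simp add: field_simps)
  qed
  have "real (n choose k) * real (k\<^sup>2 choose k) \<le> (real n ^ k / fact k) * (real (k\<^sup>2) ^ k / fact k)"
    by (intro mult_mono c) auto
  also have "\<dots> = real n ^ k * (real k ^ k / fact k)\<^sup>2"
    by (simp add: power2_eq_square power_mult_distrib)
  also have "\<dots> \<le> real n ^ k * (exp 1 ^ k)\<^sup>2"
    by (intro mult_left_mono power_mono power_over_fact_le_exp) auto
  finally have "real (n choose k) * real (k\<^sup>2 choose k) * p ^ k \<le> real n ^ k * (exp 1 ^ k)\<^sup>2 * p ^ k"
    using assms by (intro mult_right_mono) auto
  also have "\<dots> = ((exp 1)\<^sup>2 * real n * p) ^ k"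
    by (simp add: power_mult_distrib power2_eq_square)
  finally show ?thesis .
qed

context
  fixes n :: nat and p :: real
  assumes p: "0 \<le> p" "p \<le> 1"
begin

text \<open>The three kinds of fillable path have at most n^2, n^3 and n^4 placements and require 2,
  3 and 4 distinct arcs.\<close>

lemma expectation_card_fillable_paths:
  "measure_pmf.expectation (er_digraph n p) (\<lambda>G. real (card (fillable_paths G)))
    \<le> (real n * p)\<^sup>2 + (real n * p) ^ 3 + (real n * p) ^ 4"
proof -
  let ?V = "{1..n}"
  define I2 where "I2 = possible_arcs n"
  define S2 :: "nat \<times> nat \<Rightarrow> (nat \<times> nat) set" where "S2 = (\<lambda>(u, v). {(u, v), (v, u)})"
  define I3 where "I3 = {(u, v, w) \<in> ?V \<times> ?V \<times> ?V. u \<noteq> v \<and> v \<noteq> w \<and> u \<noteq> w}"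
  define S3 :: "nat \<times> nat \<times> nat \<Rightarrow> (nat \<times> nat) set"
    where "S3 = (\<lambda>(u, v, w). {(u, v), (v, w), (u, w)})"
  \<comment> \<open>The case \<open>u = w\<close> is left in: the four arcs are distinct even then,
    as \<open>v\<close> and \<open>v'\<close> differ and there are no loops.\<close>
  define I4 where "I4 = {(u, v, v', w) \<in> ?V \<times> ?V \<times> ?V \<times> ?V.
    u \<noteq> v \<and> v \<noteq> w \<and> u \<noteq> v' \<and> v' \<noteq> w \<and> v \<noteq> v'}"
  define S4 :: "nat \<times> nat \<times> nat \<times> nat \<Rightarrow> (nat \<times> nat) set"
    where "S4 = (\<lambda>(u, v, v', w). {(u, v), (v, w), (u, v'), (v', w)})"
  have sub: "I2 \<subseteq> ?V \<times> ?V" "I3 \<subseteq> ?V \<times> ?V \<times> ?V" "I4 \<subseteq> ?V \<times> ?V \<times> ?V \<times> ?V"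
    by (auto simp: I2_def I3_def I4_def possible_arcs_def)
  have fin: "finite I2" "finite I3" "finite I4"
    by (rule finite_subset[OF sub(1)] finite_subset[OF sub(2)] finite_subset[OF sub(3)]; simp)+
  have card: "card I2 \<le> n ^ 2" "card I3 \<le> n ^ 3" "card I4 \<le> n ^ 4"
    using card_mono[OF _ sub(1)] card_mono[OF _ sub(2)] card_mono[OF _ sub(3)]
    by (simp_all add: card_cartesian_product eval_nat_numeral mult.assoc)
  let ?f = "\<lambda>I S G. real (card {i \<in> I. S i \<subseteq> parcs G})"
  have E2: "measure_pmf.expectation (er_digraph n p) (?f I2 S2) \<le> (real n * p)\<^sup>2"
  proof -
    have "measure_pmf.expectation (er_digraph n p) (?f I2 S2) = (\<Sum>i\<in>I2. p ^ card (S2 i))"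
      by (rule expectation_card_arc_patterns[OF p fin(1)])
         (auto simp: I2_def S2_def possible_arcs_def)
    also have "\<dots> = (\<Sum>i\<in>I2. p ^ 2)"
      by (intro sum.cong refl arg_cong[where f = "(^) p"])
         (auto simp: I2_def S2_def possible_arcs_def)
    also have "\<dots> \<le> real (n ^ 2) * p ^ 2"
      using p card(1) by (simp only: sum_constant) (intro mult_right_mono, auto)
    finally show ?thesis by (simp add: power_mult_distrib)
  qed
  have E3: "measure_pmf.expectation (er_digraph n p) (?f I3 S3) \<le> (real n * p) ^ 3"
  proof -
    have "measure_pmf.expectation (er_digraph n p) (?f I3 S3) = (\<Sum>i\<in>I3. p ^ card (S3 i))"
      by (rule expectation_card_arc_patterns[OF p fin(2)])
         (auto simp: I3_def S3_def possible_arcs_def)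
    also have "\<dots> = (\<Sum>i\<in>I3. p ^ 3)"
      by (intro sum.cong refl arg_cong[where f = "(^) p"])
         (auto simp: I3_def S3_def card_insert_if)
    also have "\<dots> \<le> real (n ^ 3) * p ^ 3"
      using p card(2) by (simp only: sum_constant) (intro mult_right_mono, auto simp flip: of_nat_power)
    finally show ?thesis by (simp add: power_mult_distrib)
  qed
  have E4: "measure_pmf.expectation (er_digraph n p) (?f I4 S4) \<le> (real n * p) ^ 4"
  proof -
    have "measure_pmf.expectation (er_digraph n p) (?f I4 S4) = (\<Sum>i\<in>I4. p ^ card (S4 i))"
      by (rule expectation_card_arc_patterns[OF p fin(3)])
         (auto simp: I4_def S4_def possible_arcs_def)
    also have "\<dots> = (\<Sum>i\<in>I4. p ^ 4)"
      by (intro sum.cong refl arg_cong[where f = "(^) p"])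
         (auto simp: I4_def S4_def card_insert_if)
    also have "\<dots> \<le> real (n ^ 4) * p ^ 4"
      using p card(3) by (simp only: sum_constant) (intro mult_right_mono, auto simp flip: of_nat_power)
    finally show ?thesis by (simp add: power_mult_distrib)
  qed
  have "card (fillable_paths G) \<le> card {i \<in> I2. S2 i \<subseteq> parcs G} + card {i \<in> I3. S3 i \<subseteq> parcs G}
      + card {i \<in> I4. S4 i \<subseteq> parcs G}" if G: "G \<in> set_pmf (er_digraph n p)" for G
  proof -
    let ?A2 = "(\<lambda>(u, v). (u, v, u)) ` {i \<in> I2. S2 i \<subseteq> parcs G}"
    let ?A3 = "{i \<in> I3. S3 i \<subseteq> parcs G}"
    let ?A4 = "(\<lambda>(u, v, v', w). (u, v, w)) ` {i \<in> I4. S4 i \<subseteq> parcs G}"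
    have *: "(u, v) \<in> possible_arcs n" if "(u, v) \<in> parcs G" for u v
      using set_pmf_er_digraph(2)[OF G] that by blast
    have "fillable_paths G \<subseteq> ?A2 \<union> ?A3 \<union> ?A4"
    proof (rule subsetI, unfold split_paired_all)
      fix u v w assume "(u, v, w) \<in> fillable_paths G"
      then have uvw: "(u, v) \<in> parcs G" "(v, w) \<in> parcs G" and
        cs: "u = w \<or> (u, w) \<in> parcs G \<or> (\<exists>v'. v' \<noteq> v \<and> (u, v') \<in> parcs G \<and> (v', w) \<in> parcs G)"
        by (auto simp: fillable_paths_def)
      from cs consider "u = w" | "(u, w) \<in> parcs G"
        | v' where "v' \<noteq> v" "(u, v') \<in> parcs G" "(v', w) \<in> parcs G" by blast
      then show "(u, v, w) \<in> ?A2 \<union> ?A3 \<union> ?A4"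
      proof cases
        case 1
        then have "(u, v) \<in> {i \<in> I2. S2 i \<subseteq> parcs G}"
          using uvw * by (auto simp: I2_def S2_def)
        then show ?thesis using 1 by force
      next
        case 2
        then have "(u, v, w) \<in> ?A3"
          using uvw *[OF uvw(1)] *[OF uvw(2)] *[OF 2] by (auto simp: I3_def S3_def possible_arcs_def)
        then show ?thesis by blast
      next
        case 3
        then have "(u, v, v', w) \<in> {i \<in> I4. S4 i \<subseteq> parcs G}"
          using uvw *[OF uvw(1)] *[OF uvw(2)] *[OF 3(2)] *[OF 3(3)]
          by (auto simp: I4_def S4_def possible_arcs_def)
        then show ?thesis by force
      qed
    qed
    then have "card (fillable_paths G) \<le> card (?A2 \<union> ?A3 \<union> ?A4)"
      using fin by (intro card_mono) auto
    also have "\<dots> \<le> card (?A2 \<union> ?A3) + card ?A4" by (rule card_Un_le)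
    also have "\<dots> \<le> card ?A2 + card ?A3 + card ?A4" by (intro add_right_mono card_Un_le)
    also have "\<dots> \<le> card {i \<in> I2. S2 i \<subseteq> parcs G} + card ?A3 + card {i \<in> I4. S4 i \<subseteq> parcs G}"
      using fin by (intro add_mono card_image_le order.refl) auto
    finally show ?thesis .
  qed
  then have "measure_pmf.expectation (er_digraph n p) (\<lambda>G. real (card (fillable_paths G)))
      \<le> measure_pmf.expectation (er_digraph n p) (\<lambda>G. ?f I2 S2 G + ?f I3 S3 G + ?f I4 S4 G)"
    by (intro pmf_expectation_mono finite_set_pmf_er_digraph) (simp flip: of_nat_add)
  also have "\<dots> = measure_pmf.expectation (er_digraph n p) (?f I2 S2)
      + measure_pmf.expectation (er_digraph n p) (?f I3 S3)
      + measure_pmf.expectation (er_digraph n p) (?f I4 S4)"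
    by (simp add: Bochner_Integration.integral_add)
  finally show ?thesis using E2 E3 E4 by linarith
qed

text \<open>Union bound over vertex sets and arc sets, grouped by their common size k. Arc sets are
  counted among all k^2 pairs, loops included, which gives a plain binomial coefficient.\<close>

lemma prob_dense_arc_set_le:
  "measure_pmf.prob (er_digraph n p)
     {G. \<exists>U S. U \<subseteq> {1..n} \<and> U \<noteq> {} \<and> S \<subseteq> parcs G \<and> S \<subseteq> U \<times> U \<and> card S = card U}
   \<le> (\<Sum>k=1..n. ((exp 1)\<^sup>2 * real n * p) ^ k)" (is "measure_pmf.prob ?M ?A \<le> _")
proof -
  define P where "P U = {S. S \<subseteq> U \<times> U \<and> S \<subseteq> possible_arcs n \<and> card S = card U}" for U :: "nat set"
  define Us where "Us = {U. U \<subseteq> {1..n} \<and> U \<noteq> {}}"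
  have finP: "finite (P U)" for U
    by (rule finite_subset[of _ "Pow (possible_arcs n)"]) (auto simp: P_def finite_possible_arcs)
  have finUs: "finite Us" by (rule finite_subset[of _ "Pow {1..n}"]) (auto simp: Us_def)
  have cardP: "card (P U) \<le> (card U)\<^sup>2 choose card U" if "U \<in> Us" for U
  proof -
    have finU: "finite U" using that finite_subset by (auto simp: Us_def)
    have "card (P U) \<le> card {S. S \<subseteq> U \<times> U \<and> card S = card U}"
      by (rule card_mono) (auto simp: P_def finU intro: finite_subset[of _ "Pow (U \<times> U)"])
    then show ?thesis using finU by (simp add: n_subsets card_cartesian_product power2_eq_square)
  qed
  have "measure_pmf.prob ?M ?A \<le> measure_pmf.prob ?M (\<Union>U\<in>Us. \<Union>S\<in>P U. {G. S \<subseteq> parcs G})"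
  proof (rule pmf_prob_mono)
    fix G assume G: "G \<in> set_pmf ?M" "G \<in> ?A"
    then obtain U S where US: "U \<in> Us" "S \<subseteq> parcs G" "S \<subseteq> U \<times> U" "card S = card U"
      unfolding Us_def by blast
    then have "S \<in> P U" using set_pmf_er_digraph(2)[OF G(1)] by (auto simp: P_def)
    then show "G \<in> (\<Union>U\<in>Us. \<Union>S\<in>P U. {G. S \<subseteq> parcs G})" using US by blast
  qed
  also have "\<dots> \<le> (\<Sum>U\<in>Us. measure_pmf.prob ?M (\<Union>S\<in>P U. {G. S \<subseteq> parcs G}))"
    by (rule measure_UNION_le[OF finUs]) auto
  also have "\<dots> \<le> (\<Sum>U\<in>Us. \<Sum>S\<in>P U. measure_pmf.prob ?M {G. S \<subseteq> parcs G})"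
    by (intro sum_mono measure_UNION_le finP) auto
  also have "\<dots> = (\<Sum>U\<in>Us. \<Sum>S\<in>P U. p ^ card U)"
    by (intro sum.cong refl) (auto simp: P_def prob_arcs_subset[OF p])
  also have "\<dots> \<le> (\<Sum>U\<in>Us. real ((card U)\<^sup>2 choose card U) * p ^ card U)"
    using p cardP by (intro sum_mono) (auto intro!: mult_right_mono)
  also have "\<dots> = (\<Sum>k=1..n. \<Sum>U | U \<in> Us \<and> card U = k. real ((card U)\<^sup>2 choose card U) * p ^ card U)"
  proof (rule sum.group[symmetric])
    show "card ` Us \<subseteq> {1..n}"
    proof
      fix k assume "k \<in> card ` Us"
      then obtain U where "U \<subseteq> {1..n}" "U \<noteq> {}" "k = card U" by (auto simp: Us_def)
      then show "k \<in> {1..n}"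
        using card_mono[of "{1..n}" U] finite_subset[of U "{1..n}"] by (auto simp: Suc_le_eq card_gt_0_iff)
    qed
  qed (auto simp: finUs)
  also have "\<dots> = (\<Sum>k=1..n. real (n choose k) * real (k\<^sup>2 choose k) * p ^ k)"
  proof (rule sum.cong[OF refl])
    fix k assume k: "k \<in> {1..n}"
    then have "{U. U \<in> Us \<and> card U = k} = {U. U \<subseteq> {1..n} \<and> card U = k}"
      by (auto simp: Us_def)
    then have "card {U. U \<in> Us \<and> card U = k} = n choose k" by (simp add: n_subsets)
    then show "(\<Sum>U | U \<in> Us \<and> card U = k. real ((card U)\<^sup>2 choose card U) * p ^ card U)
        = real (n choose k) * real (k\<^sup>2 choose k) * p ^ k"
      by (simp add: sum.cong[of _ _ "\<lambda>U. real ((card U)\<^sup>2 choose card U) * p ^ card U"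
            "\<lambda>_. real (k\<^sup>2 choose k) * p ^ k"])
  qed
  also have "\<dots> \<le> (\<Sum>k=1..n. ((exp 1)\<^sup>2 * real n * p) ^ k)"
    by (intro sum_mono choose_square_bound p)
  finally show ?thesis .
qed

text \<open>For fixed \<open>a\<close>, \<open>b\<close>, \<open>c\<close> the stars from different
  \<open>x\<close> use disjoint arcs. Leaving out the targets themselves, where a star would contain
  a loop, keeps at least n - 3 candidates; coinciding targets only make the stars smaller.\<close>

lemma prob_no_common_in_neighbour_le:
  "measure_pmf.prob (er_digraph n p)
     {G. \<exists>a\<in>{1..n}. \<exists>b\<in>{1..n}. \<exists>c\<in>{1..n}.
        \<nexists>x. (x, a) \<in> parcs G \<and> (x, b) \<in> parcs G \<and> (x, c) \<in> parcs G}
   \<le> real n ^ 3 * (1 - p ^ 3) ^ (n - 3)" (is "measure_pmf.prob ?M ?A \<le> _")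
proof -
  let ?V = "{1..n}"
  let ?T = "?V \<times> ?V \<times> ?V"
  define X where "X = (\<lambda>(a, b, c). ?V - {a, b, c})"
  define S :: "nat \<times> nat \<times> nat \<Rightarrow> nat \<Rightarrow> (nat \<times> nat) set"
    where "S = (\<lambda>(a, b, c) x. {x} \<times> {a, b, c})"
  have le: "measure_pmf.prob ?M {G. \<forall>x\<in>X t. \<not> S t x \<subseteq> parcs G} \<le> (1 - p ^ 3) ^ (n - 3)"
    if "t \<in> ?T" for t
  proof -
    obtain a b c where t: "t = (a, b, c)" by (cases t)
    have card3: "card {a, b, c} \<le> 3" by (simp add: card_insert_if)
    have "measure_pmf.prob ?M {G. \<forall>x\<in>X t. \<not> S t x \<subseteq> parcs G} = (\<Prod>x\<in>X t. 1 - p ^ card (S t x))"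
      using prob_arcs_subset_avoiding[OF p, of "X t" "S t" n "{}"] that
      by (auto simp: t X_def S_def possible_arcs_def disjoint_family_on_def)
    also have "\<dots> \<le> (\<Prod>x\<in>X t. 1 - p ^ 3)"
    proof (intro prod_mono conjI)
      fix x
      have "card (S t x) \<le> 3" using card3 by (simp only: t S_def case_prod_conv card_cartesian_product_singleton)
      then show "1 - p ^ card (S t x) \<le> 1 - p ^ 3" using p by (simp add: power_decreasing)
      show "0 \<le> 1 - p ^ card (S t x)" using p by (simp add: power_le_one)
    qed
    also have "\<dots> = (1 - p ^ 3) ^ card (X t)" by simp
    also have "\<dots> \<le> (1 - p ^ 3) ^ (n - 3)"
    proof (rule power_decreasing)
      have "card ?V - card {a, b, c} \<le> card (X t)"
        by (simp only: t X_def case_prod_conv) (rule diff_card_le_card_Diff, simp)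
      then show "n - 3 \<le> card (X t)" using card3 by simp
    qed (use p in \<open>auto simp: power_le_one\<close>)
    finally show ?thesis .
  qed
  have "measure_pmf.prob ?M ?A \<le> measure_pmf.prob ?M (\<Union>t\<in>?T. {G. \<forall>x\<in>X t. \<not> S t x \<subseteq> parcs G})"
  proof (rule pmf_prob_mono)
    fix G assume "G \<in> ?A"
    then obtain a b c where "(a, b, c) \<in> ?T"
      "\<nexists>x. (x, a) \<in> parcs G \<and> (x, b) \<in> parcs G \<and> (x, c) \<in> parcs G" by auto
    then show "G \<in> (\<Union>t\<in>?T. {G. \<forall>x\<in>X t. \<not> S t x \<subseteq> parcs G})"
      by (intro UN_I[of "(a, b, c)"]) (auto simp: S_def)
  qed
  also have "\<dots> \<le> (\<Sum>t\<in>?T. measure_pmf.prob ?M {G. \<forall>x\<in>X t. \<not> S t x \<subseteq> parcs G})"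
    by (rule measure_UNION_le) auto
  also have "\<dots> \<le> (\<Sum>t\<in>?T. (1 - p ^ 3) ^ (n - 3))"
    by (rule sum_mono[OF le])
  also have "\<dots> = real n ^ 3 * (1 - p ^ 3) ^ (n - 3)"
    by (simp add: card_cartesian_product power3_eq_cube)
  finally show ?thesis .
qed

end

section \<open>The Betti number of a random digraph\<close>

text \<open>Bounds the expectation of \<open>card (pverts G) + card (fillable_paths G)\<close>, by
  which the number of arcs can exceed the Betti number.\<close>

definition deficiency :: "nat \<Rightarrow> real \<Rightarrow> real" where
  "deficiency n p = real n + (real n * p)\<^sup>2 + (real n * p) ^ 3 + (real n * p) ^ 4"

text \<open>The boundary map may vary with \<open>G\<close> and the complex is left unspecified, so
  every estimate covers both Betti numbers.\<close>

context
  fixes \<beta> :: "nat pair_pre_digraph \<Rightarrow> nat"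
  assumes \<beta>: "\<And>G. pair_digraph G \<Longrightarrow>
    \<exists>D \<epsilon>. path_complex G D \<epsilon> \<and> \<beta> G = group_rank (path_homology_group D G 1)"
begin

lemma betti_le_card_arcs: "pair_digraph G \<Longrightarrow> \<beta> G \<le> card (parcs G)"
  using \<beta> path_complex.betti1_le_card_arcs by metis

lemma card_arcs_le_betti:
  "pair_digraph G \<Longrightarrow> card (parcs G) \<le> \<beta> G + card (pverts G) + card (fillable_paths G)"
  using \<beta> path_complex.card_arcs_le_betti1 by metis

context
  fixes n :: nat and p :: real
  assumes p: "0 \<le> p" "p \<le> 1"
begin

lemma expectation_betti_le:
  "measure_pmf.expectation (er_digraph n p) (\<lambda>G. real (\<beta> G)) \<le> real n * (real n - 1) * p"
proof -
  have "measure_pmf.expectation (er_digraph n p) (\<lambda>G. real (\<beta> G))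
      \<le> measure_pmf.expectation (er_digraph n p) (\<lambda>G. real (card (parcs G)))"
    by (intro pmf_expectation_mono finite_set_pmf_er_digraph)
       (simp add: betti_le_card_arcs pair_digraph_er_digraph)
  then show ?thesis by (simp add: expectation_card_arcs[OF p])
qed

lemma expectation_vertices_fillable_paths_le:
  "measure_pmf.expectation (er_digraph n p) (\<lambda>G. real (card (pverts G)) + real (card (fillable_paths G)))
    \<le> deficiency n p"
proof -
  have "measure_pmf.expectation (er_digraph n p) (\<lambda>G. real (card (pverts G))) = real n"
    by (subst integral_cong_AE[where g = "\<lambda>_. real n"])
       (auto intro!: AE_pmfI dest: set_pmf_er_digraph(1))
  then show ?thesis using expectation_card_fillable_paths[OF p, of n] by (simp add: deficiency_def)
qed

lemma expectation_betti_ge: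
  "real n * (real n - 1) * p - deficiency n p
    \<le> measure_pmf.expectation (er_digraph n p) (\<lambda>G. real (\<beta> G))"
proof -
  have "measure_pmf.expectation (er_digraph n p) (\<lambda>G. real (card (parcs G)))
      \<le> measure_pmf.expectation (er_digraph n p)
          (\<lambda>G. real (\<beta> G) + (real (card (pverts G)) + real (card (fillable_paths G))))"
  proof (intro pmf_expectation_mono finite_set_pmf_er_digraph)
    fix G assume "G \<in> set_pmf (er_digraph n p)"
    from card_arcs_le_betti[OF pair_digraph_er_digraph[OF this]]
    show "real (card (parcs G)) \<le> real (\<beta> G) + (real (card (pverts G)) + real (card (fillable_paths G)))"
      by linarith
  qed
  also have "\<dots> = measure_pmf.expectation (er_digraph n p) (\<lambda>G. real (\<beta> G))
      + measure_pmf.expectation (er_digraph n p)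
          (\<lambda>G. real (card (pverts G)) + real (card (fillable_paths G)))"
    by (rule Bochner_Integration.integral_add) simp_all
  finally show ?thesis
    using expectation_vertices_fillable_paths_le by (simp add: expectation_card_arcs[OF p])
qed

text \<open>A vanishing Betti number puts the number of arcs below the count of vertices and
  fillable paths. Then either at most half the expected arcs are present (Chebyshev) or that count
  reaches this half (Markov).\<close>

lemma prob_betti_eq_0_le:
  assumes m: "0 < real n * (real n - 1) * p"
  shows "measure_pmf.prob (er_digraph n p) {G. \<beta> G = 0}
    \<le> 6 * (deficiency n p / (real n * (real n - 1) * p))"
proof -
  let ?M = "er_digraph n p"
  define m where "m = real n * (real n - 1) * p"
  let ?f = "\<lambda>G. real (card (pverts G)) + real (card (fillable_paths G))"
  have m0: "m > 0" using assms by (simp add: m_def)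
  have n1: "1 \<le> real n" using m by (cases n) auto
  have d1: "1 \<le> deficiency n p" using n1 p by (simp add: deficiency_def add_increasing2)
  have "measure_pmf.prob ?M {G. \<beta> G = 0}
      \<le> measure_pmf.prob ?M ({G. real (card (parcs G)) \<le> m / 2} \<union> {G. m / 2 \<le> ?f G})"
  proof (rule pmf_prob_mono)
    fix G assume "G \<in> set_pmf ?M" and "G \<in> {G. \<beta> G = 0}"
    then have "card (parcs G) \<le> card (pverts G) + card (fillable_paths G)"
      using card_arcs_le_betti[OF pair_digraph_er_digraph] by fastforce
    then have "real (card (parcs G)) \<le> ?f G" by linarith
    then show "G \<in> {G. real (card (parcs G)) \<le> m / 2} \<union> {G. m / 2 \<le> ?f G}" by auto
  qed
  also have "\<dots> \<le> measure_pmf.prob ?M {G. real (card (parcs G)) \<le> m / 2}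
      + measure_pmf.prob ?M {G. m / 2 \<le> ?f G}"
    by (rule measure_Un_le) auto
  also have "\<dots> \<le> 4 / m + deficiency n p / (m / 2)"
  proof (rule add_mono)
    show "measure_pmf.prob ?M {G. real (card (parcs G)) \<le> m / 2} \<le> 4 / m"
      using prob_few_arcs[OF p m] by (simp add: m_def)
    have "measure_pmf.prob ?M {G. m / 2 \<le> ?f G} \<le> measure_pmf.expectation ?M ?f / (m / 2)"
      using m0 by (intro pmf_Markov finite_set_pmf_er_digraph) auto
    also have "\<dots> \<le> deficiency n p / (m / 2)"
      using m0 expectation_vertices_fillable_paths_le by (intro divide_right_mono) auto
    finally show "measure_pmf.prob ?M {G. m / 2 \<le> ?f G} \<le> deficiency n p / (m / 2)" .
  qed
  also have "\<dots> = (4 + 2 * deficiency n p) / m" using m0 by (simp add: field_simps)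
  \<comment> \<open>As the deficiency is at least 1, the constant 4 is absorbed into four times
    it.\<close>
  also have "\<dots> \<le> (6 * deficiency n p) / m"
    using m0 d1 by (intro divide_right_mono) auto
  finally show ?thesis by (simp only: m_def times_divide_eq_right)
qed

lemma prob_betti_neq_0_le_sparse:
  "measure_pmf.prob (er_digraph n p) {G. \<beta> G \<noteq> 0} \<le> (\<Sum>k=1..n. ((exp 1)\<^sup>2 * real n * p) ^ k)"
proof -
  have "measure_pmf.prob (er_digraph n p) {G. \<beta> G \<noteq> 0} \<le> measure_pmf.prob (er_digraph n p)
     {G. \<exists>U S. U \<subseteq> {1..n} \<and> U \<noteq> {} \<and> S \<subseteq> parcs G \<and> S \<subseteq> U \<times> U \<and> card S = card U}"
  proof (rule pmf_prob_mono)
    fix G assume G: "G \<in> set_pmf (er_digraph n p)" "G \<in> {G. \<beta> G \<noteq> 0}"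
    obtain D \<epsilon> where D: "path_complex G D \<epsilon>" "\<beta> G = group_rank (path_homology_group D G 1)"
      using \<beta>[OF pair_digraph_er_digraph[OF G(1)]] by blast
    interpret path_complex G D \<epsilon> by fact
    obtain U S where "U \<subseteq> pverts G" "U \<noteq> {}" "S \<subseteq> parcs G" "S \<subseteq> U \<times> U" "card S = card U"
      by (rule nonzero_cycle_dense_support) (use G D in simp)
    then have "U \<subseteq> {1..n} \<and> U \<noteq> {} \<and> S \<subseteq> parcs G \<and> S \<subseteq> U \<times> U \<and> card S = card U"
      by (simp add: set_pmf_er_digraph(1)[OF G(1)])
    then show "G \<in> {G. \<exists>U S. U \<subseteq> {1..n} \<and> U \<noteq> {} \<and> S \<subseteq> parcs G \<and> S \<subseteq> U \<times> U \<and> card S = card U}"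
      by blast
  qed
  also note prob_dense_arc_set_le[OF p]
  finally show ?thesis .
qed

lemma prob_betti_neq_0_le_dense:
  "measure_pmf.prob (er_digraph n p) {G. \<beta> G \<noteq> 0} \<le> real n ^ 3 * (1 - p ^ 3) ^ (n - 3)"
proof -
  have "measure_pmf.prob (er_digraph n p) {G. \<beta> G \<noteq> 0} \<le> measure_pmf.prob (er_digraph n p)
     {G. \<exists>a\<in>{1..n}. \<exists>b\<in>{1..n}. \<exists>c\<in>{1..n}.
        \<nexists>x. (x, a) \<in> parcs G \<and> (x, b) \<in> parcs G \<and> (x, c) \<in> parcs G}"
  proof (rule pmf_prob_mono)
    fix G assume G: "G \<in> set_pmf (er_digraph n p)" "G \<in> {G. \<beta> G \<noteq> 0}"
    obtain D \<epsilon> where D: "path_complex G D \<epsilon>" "\<beta> G = group_rank (path_homology_group D G 1)"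
      using \<beta>[OF pair_digraph_er_digraph[OF G(1)]] by blast
    interpret path_complex G D \<epsilon> by fact
    have "\<not> (\<forall>a\<in>pverts G. \<forall>b\<in>pverts G. \<forall>c\<in>pverts G.
        \<exists>x. (x, a) \<in> parcs G \<and> (x, b) \<in> parcs G \<and> (x, c) \<in> parcs G)"
      using betti1_eq_0_if_common_in_neighbours G(2) D(2) by force
    then show "G \<in> {G. \<exists>a\<in>{1..n}. \<exists>b\<in>{1..n}. \<exists>c\<in>{1..n}.
        \<nexists>x. (x, a) \<in> parcs G \<and> (x, b) \<in> parcs G \<and> (x, c) \<in> parcs G}"
      unfolding set_pmf_er_digraph(1)[OF G(1)] by blast
  qed
  also note prob_no_common_in_neighbour_le[OF p]
  finally show ?thesis .
qed

end

end

section \<open>Asymptotics of the bounds\<close>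

lemma whpI:
  assumes "eventually (\<lambda>n. measure_pmf.prob (M n) {x. \<not> P x} \<le> f n) sequentially" "f \<longlonglongrightarrow> 0"
  shows "whp M P"
proof -
  have "(\<lambda>n. measure_pmf.prob (M n) {x. \<not> P x}) \<longlonglongrightarrow> 0"
    using assms by (intro tendsto_sandwich[OF _ assms(1) tendsto_const assms(2)]) auto
  then have "(\<lambda>n. 1 - measure_pmf.prob (M n) {x. \<not> P x}) \<longlonglongrightarrow> 1 - 0"
    by (intro tendsto_intros)
  moreover have "1 - measure_pmf.prob (M n) {x. \<not> P x} = measure_pmf.prob (M n) {x. P x}" for n
    using measure_pmf.prob_compl[of "{x. \<not> P x}" "M n"] by (simp add: Compl_eq_Diff_UNIV[symmetric] Collect_neg_eq[symmetric])
  ultimately show ?thesis by (simp add: whp_def)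
qed

lemma deficiency_ratio_tendsto_0:
  fixes \<alpha> :: real
  assumes "-1 < \<alpha>" "\<alpha> < -2/3"
  defines "p \<equiv> \<lambda>n::nat. real n powr \<alpha>"
  shows "(\<lambda>n. deficiency n (p n) / (real n * (real n - 1) * p n)) \<longlonglongrightarrow> 0"
proof -
  have lim: "(\<lambda>n. real n powr s) \<longlonglongrightarrow> 0" if "s < 0" for s
    using tendsto_neg_powr[OF that filterlim_real_sequentially] .
  have "(\<lambda>n. 2 * (real n powr (-1 - \<alpha>) + real n powr \<alpha> + real n powr (1 + 2 * \<alpha>)
      + real n powr (2 + 3 * \<alpha>))) \<longlonglongrightarrow> 2 * (0 + 0 + 0 + 0)"
    using assms by (intro tendsto_intros lim) auto
  then have "(\<lambda>n. 2 * (real n powr (-1 - \<alpha>) + real n powr \<alpha> + real n powr (1 + 2 * \<alpha>)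
      + real n powr (2 + 3 * \<alpha>))) \<longlonglongrightarrow> 0"
    by (simp only: add_0_left mult_zero_right)
  moreover have "eventually (\<lambda>n. norm (deficiency n (p n)
    / (real n * (real n - 1) * p n)) \<le> 2 * (real n powr (-1 - \<alpha>) + real n powr \<alpha>
      + real n powr (1 + 2 * \<alpha>) + real n powr (2 + 3 * \<alpha>))) sequentially"
    using eventually_ge_at_top[of 2]
  proof eventually_elim
    case (elim n)
    define x where "x = real n"
    have x: "x \<ge> 2" using elim by (simp add: x_def)
    define q where "q = x powr \<alpha>"
    have q: "q > 0" using x by (simp add: q_def)
    have pow: "x powr (-1 - \<alpha>) = 1 / (x * q)"
      using x by (simp add: q_def powr_diff powr_minus_divide)
    have "x powr (1 + 2 * \<alpha>) = x * x powr (2 * \<alpha>)" "x powr (2 + 3 * \<alpha>) = x\<^sup>2 * x powr (3 * \<alpha>)"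
      using x by (simp_all add: powr_add)
    moreover have "x powr (2 * \<alpha>) = q\<^sup>2" "x powr (3 * \<alpha>) = q ^ 3"
      using x by (simp_all add: q_def powr_power mult.commute)
    ultimately have pow': "x powr (1 + 2 * \<alpha>) = x * q\<^sup>2" "x powr (2 + 3 * \<alpha>) = x\<^sup>2 * q ^ 3"
      by simp_all
    let ?N = "x + (x * q)\<^sup>2 + (x * q) ^ 3 + (x * q) ^ 4"
    \<comment> \<open>For x \<ge> 2 the factor x - 1 is at least x / 2; this is the origin of the 2
      in the majorant.\<close>
    have "?N / (x * (x - 1) * q) \<le> ?N / (x\<^sup>2 * q / 2)"
    proof (rule divide_left_mono)
      have "x / 2 * (x * q) \<le> (x - 1) * (x * q)" using x q by (intro mult_right_mono) auto
      then show "x\<^sup>2 * q / 2 \<le> x * (x - 1) * q" by (simp add: power2_eq_square algebra_simps)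
    qed (use x q in auto)
    also have "\<dots> = 2 * (1 / (x * q) + q + x * q\<^sup>2 + x\<^sup>2 * q ^ 3)"
      using x q by (simp add: field_simps power2_eq_square power3_eq_cube eval_nat_numeral)
    finally have "?N / (x * (x - 1) * q) \<le> 2 * (1 / (x * q) + q + x * q\<^sup>2 + x\<^sup>2 * q ^ 3)" .
    moreover have "0 \<le> ?N / (x * (x - 1) * q)" using x q by auto
    ultimately show ?case
      unfolding deficiency_def p_def x_def[symmetric] pow pow' q_def[symmetric] real_norm_def
      by (simp only: abs_of_nonneg)
  qed
  ultimately show ?thesis by (rule Lim_null_comparison[rotated])
qed

theorem theorem1p3:
  fixes \<alpha> :: real and p :: "nat \<Rightarrow> real"
  assumes "\<alpha> \<le> 0"
    and "\<And>n. p n = real n powr \<alpha>"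
  shows "\<forall>\<beta>\<^sub>1 \<in> {path_betti 1, reg_path_betti 1}.
    (-1 < \<alpha> \<and> \<alpha> < -2/3 \<longrightarrow>
       (\<lambda>n. measure_pmf.expectation (er_digraph n (p n)) (\<lambda>G. real (\<beta>\<^sub>1 G))
              / (real n * (real n - 1) * p n)) \<longlonglongrightarrow> 1) \<and>
    (-1 < \<alpha> \<and> \<alpha> < -2/3 \<longrightarrow> whp (\<lambda>n. er_digraph n (p n)) (\<lambda>G. \<beta>\<^sub>1 G > 0)) \<and>
    (\<alpha> < -1 \<longrightarrow> whp (\<lambda>n. er_digraph n (p n)) (\<lambda>G. \<beta>\<^sub>1 G = 0)) \<and>
    (\<alpha> > -1/3 \<longrightarrow> whp (\<lambda>n. er_digraph n (p n)) (\<lambda>G. \<beta>\<^sub>1 G = 0))"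
proof
  fix \<beta>\<^sub>1 :: "nat pair_pre_digraph \<Rightarrow> nat"
  assume "\<beta>\<^sub>1 \<in> {path_betti 1, reg_path_betti 1}"
  then have \<beta>: "\<exists>D \<epsilon>. path_complex G D \<epsilon> \<and> \<beta>\<^sub>1 G = group_rank (path_homology_group D G 1)"
    if "pair_digraph G" for G
    using path_complex_path_boundary[OF that] path_complex_reg_path_boundary[OF that]
    by (auto simp: path_betti_def reg_path_betti_def)
  have p: "0 \<le> p n" "p n \<le> 1" for n
  proof -
    show "0 \<le> p n" by (simp add: assms(2))
    show "p n \<le> 1"
    \<comment> \<open>\<open>0 powr \<alpha>\<close> is 0 by convention, even for \<alpha> = 0;
      monotonicity in the exponent takes over from base 1.\<close>
    proof (cases "n = 0")
      case False
      then have "real n powr \<alpha> \<le> real n powr 0"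
        using assms(1) by (intro powr_mono) auto
      then show ?thesis using False by (simp add: assms(2))
    qed (simp add: assms(2))
  qed
  let ?m = "\<lambda>n. real n * (real n - 1) * p n"
  let ?d = "\<lambda>n. deficiency n (p n)"
  have m: "?m n > 0" if "n \<ge> 2" for n
    using that by (auto simp: assms(2))
  have ratio: "(\<lambda>n. ?d n / ?m n) \<longlonglongrightarrow> 0" if "-1 < \<alpha>" "\<alpha> < -2/3"
    using deficiency_ratio_tendsto_0[OF that] by (simp only: assms(2))
  have one_minus: "1 - d / c = (c - d) / c" if "c > 0" for c d :: real
    using that by (simp add: field_simps)
  have a: "(\<lambda>n. measure_pmf.expectation (er_digraph n (p n)) (\<lambda>G. real (\<beta>\<^sub>1 G)) / ?m n) \<longlonglongrightarrow> 1"
    if \<alpha>: "-1 < \<alpha>" "\<alpha> < -2/3"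
  proof (rule tendsto_sandwich)
    show "(\<lambda>n. 1 - ?d n / ?m n) \<longlonglongrightarrow> 1"
      using tendsto_diff[OF tendsto_const ratio[OF \<alpha>], of 1] by simp
    show "\<forall>\<^sub>F n in sequentially. 1 - ?d n / ?m n
        \<le> measure_pmf.expectation (er_digraph n (p n)) (\<lambda>G. real (\<beta>\<^sub>1 G)) / ?m n"
      using eventually_ge_at_top[of 2]
    proof eventually_elim
      case (elim n)
      have "1 - ?d n / ?m n = (?m n - ?d n) / ?m n"
        by (rule one_minus[OF m[OF elim]])
      also have "\<dots> \<le> measure_pmf.expectation (er_digraph n (p n)) (\<lambda>G. real (\<beta>\<^sub>1 G)) / ?m n"
        by (rule divide_right_mono[OF expectation_betti_ge[OF \<beta> p] less_imp_le[OF m[OF elim]]])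
      finally show ?case .
    qed
    show "\<forall>\<^sub>F n in sequentially.
        measure_pmf.expectation (er_digraph n (p n)) (\<lambda>G. real (\<beta>\<^sub>1 G)) / ?m n \<le> 1"
      using eventually_ge_at_top[of 2]
    proof eventually_elim
      case (elim n)
      show ?case
        by (subst divide_le_eq_1_pos[OF m[OF elim]], rule expectation_betti_le[OF \<beta> p])
    qed
  qed auto
  have b: "whp (\<lambda>n. er_digraph n (p n)) (\<lambda>G. \<beta>\<^sub>1 G > 0)" if \<alpha>: "-1 < \<alpha>" "\<alpha> < -2/3"
  proof (rule whpI)
    show "(\<lambda>n. 6 * (?d n / ?m n)) \<longlonglongrightarrow> 0"
      using tendsto_mult[OF tendsto_const ratio[OF \<alpha>], of 6] by simp
    show "\<forall>\<^sub>F n in sequentially. measure_pmf.prob (er_digraph n (p n)) {G. \<not> \<beta>\<^sub>1 G > 0} \<le> 6 * (?d n / ?m n)"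
      using eventually_ge_at_top[of 2]
    proof eventually_elim
      case (elim n)
      show ?case
        using prob_betti_eq_0_le[OF \<beta> p m[OF elim]] by simp
    qed
  qed
  have c: "whp (\<lambda>n. er_digraph n (p n)) (\<lambda>G. \<beta>\<^sub>1 G = 0)" if \<alpha>: "\<alpha> < -1"
  proof (rule whpI)
    \<comment> \<open>The ratio of the geometric series, equal to e^2 times n^(1+\<alpha>).\<close>
    define q where "q n = (exp 1)\<^sup>2 * real n * p n" for n
    have q: "q \<longlonglongrightarrow> 0"
    proof -
      have "(\<lambda>n. (exp 1)\<^sup>2 * real n powr (1 + \<alpha>)) \<longlonglongrightarrow> (exp 1)\<^sup>2 * 0"
        using \<alpha> by (intro tendsto_intros tendsto_neg_powr filterlim_real_sequentially) auto
      moreover have "(exp 1)\<^sup>2 * real n powr (1 + \<alpha>) = q n" for n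
        by (cases "n = 0") (auto simp: q_def assms(2) powr_add)
      ultimately show ?thesis by simp
    qed
    have "(\<lambda>n. q n / (1 - q n)) \<longlonglongrightarrow> 0 / (1 - 0)"
      by (intro tendsto_intros q) auto
    then show "(\<lambda>n. q n / (1 - q n)) \<longlonglongrightarrow> 0" by simp
    have "\<forall>\<^sub>F n in sequentially. q n < 1" using order_tendstoD(2)[OF q] by simp
    then show "\<forall>\<^sub>F n in sequentially.
        measure_pmf.prob (er_digraph n (p n)) {G. \<not> \<beta>\<^sub>1 G = 0} \<le> q n / (1 - q n)"
    proof eventually_elim
      case (elim n)
      have q0: "0 \<le> q n" using p(1) by (simp add: q_def)
      have "measure_pmf.prob (er_digraph n (p n)) {G. \<not> \<beta>\<^sub>1 G = 0} \<le> (\<Sum>k=1..n. q n ^ k)"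
        using prob_betti_neq_0_le_sparse[OF \<beta> p, of n] by (simp add: q_def)
      also have "\<dots> = (q n - q n ^ Suc n) / (1 - q n)"
        using elim by (subst sum_gp) auto
      also have "\<dots> \<le> q n / (1 - q n)"
        using elim q0 by (intro divide_right_mono) auto
      finally show ?case .
    qed
  qed
  have d: "whp (\<lambda>n. er_digraph n (p n)) (\<lambda>G. \<beta>\<^sub>1 G = 0)" if \<alpha>: "\<alpha> > -1/3"
  proof (rule whpI)
    \<comment> \<open>The exponent in n p^3 = n^\<delta>; its positivity lets the exponential beat
      the n^3 triples.\<close>
    define \<delta> where "\<delta> = 1 + 3 * \<alpha>"
    have \<delta>: "\<delta> > 0" using \<alpha> by (simp add: \<delta>_def)
    show "(\<lambda>n. real n ^ 3 * exp (3 - real n powr \<delta>)) \<longlonglongrightarrow> 0"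
      using \<delta> by real_asymp
    show "\<forall>\<^sub>F n in sequentially. measure_pmf.prob (er_digraph n (p n)) {G. \<not> \<beta>\<^sub>1 G = 0}
        \<le> real n ^ 3 * exp (3 - real n powr \<delta>)"
      using eventually_ge_at_top[of 3]
    proof eventually_elim
      case (elim n)
      have p3: "0 \<le> p n ^ 3" "p n ^ 3 \<le> 1" using p[of n] by (auto simp: power_le_one)
      have np3: "real n * p n ^ 3 = real n powr \<delta>"
        using elim by (simp add: assms(2) \<delta>_def powr_add powr_power mult.commute)
      have "measure_pmf.prob (er_digraph n (p n)) {G. \<not> \<beta>\<^sub>1 G = 0}
          \<le> real n ^ 3 * (1 - p n ^ 3) ^ (n - 3)"
        using prob_betti_neq_0_le_dense[OF \<beta> p, of n] by simp
      also have "\<dots> \<le> real n ^ 3 * exp (- (p n ^ 3)) ^ (n - 3)"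
        using p3 exp_ge_add_one_self[of "- (p n ^ 3)"] by (intro mult_left_mono power_mono) auto
      \<comment> \<open>The exponent n - 3 is a true difference as n \<ge> 3; the excess 3 p^3 is
        then at most 3.\<close>
      also have "\<dots> = real n ^ 3 * exp (3 * p n ^ 3 - real n * p n ^ 3)"
        using elim by (simp add: of_nat_diff algebra_simps flip: exp_of_nat_mult)
      also have "\<dots> \<le> real n ^ 3 * exp (3 - real n powr \<delta>)"
        using p3 by (intro mult_left_mono) (auto simp: np3)
      finally show ?case .
    qed
  qed
  show "(-1 < \<alpha> \<and> \<alpha> < -2/3 \<longrightarrow>
       (\<lambda>n. measure_pmf.expectation (er_digraph n (p n)) (\<lambda>G. real (\<beta>\<^sub>1 G))
              / (real n * (real n - 1) * p n)) \<longlonglongrightarrow> 1) \<and>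
    (-1 < \<alpha> \<and> \<alpha> < -2/3 \<longrightarrow> whp (\<lambda>n. er_digraph n (p n)) (\<lambda>G. \<beta>\<^sub>1 G > 0)) \<and>
    (\<alpha> < -1 \<longrightarrow> whp (\<lambda>n. er_digraph n (p n)) (\<lambda>G. \<beta>\<^sub>1 G = 0)) \<and>
    (\<alpha> > -1/3 \<longrightarrow> whp (\<lambda>n. er_digraph n (p n)) (\<lambda>G. \<beta>\<^sub>1 G = 0))"
    using a b c d by blast
qed

end
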